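(* Let $n\geq 3$ be an integer, let $\lambda\in\mathbb{C}\setminus\{0\}$, and let $f_\lambda(z)=z^n+\dfrac{\lambda^2}{z^n-\lambda}$, viewed as a rational map of $\widehat{\mathbb{C}}$. Then the Julia set of $f_\lambda$ is neither a Cantor set of circles nor a Sierpiński curve. Moreover, $f_\lambda$ has no Herman rings.
   Context: A subset of the Riemann sphere $\widehat{\mathbb{C}}$ is called a Cantor set of circles if it consists of uncountably many closed Jordan curves and is homeomorphic to $\mathcal{C}\times\mathbb{S}^1$, where $\mathcal{C}$ is the Cantor middle third set and $\mathbb{S}^1$ is the unit circle. A Sierpiński curve is a planar set homeomorphic to the Sierpiński carpet fractal; equivalently (Whyburn) a planar set that is compact, connected, locally connected, nowhere dense, and such that any two complementary domains are bounded by disjoint simple closed curves. *)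

theory Defs
  imports "HOL-Complex_Analysis.Complex_Analysis"
begin

datatype rsphere = Fin complex | Infty

text \<open>Inverse stereographic projection onto the unit sphere of
  \<open>\<complex> \<times> \<real>\<close>, with \<open>Infty\<close> going to the north pole. The
  chordal metric is the distance pulled back along it.\<close>

fun stereo :: "rsphere \<Rightarrow> complex \<times> real" where
  "stereo (Fin z) =
     ((2 / ((cmod z)\<^sup>2 + 1)) *\<^sub>R z, ((cmod z)\<^sup>2 - 1) / ((cmod z)\<^sup>2 + 1))"
| "stereo Infty = (0, 1)"

lemma stereo_snd_less: "snd (stereo (Fin z)) < 1"
proof -
  have "(cmod z)\<^sup>2 + 1 > 0" by (simp add: add_nonneg_pos)
  then show ?thesis by (simp add: divide_simps)
qed

lemma stereo_Fin_inj:
  assumes "stereo (Fin z) = stereo (Fin w)"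
  shows "z = w"
proof -
  let ?a = "(cmod z)\<^sup>2 + 1" and ?b = "(cmod w)\<^sup>2 + 1"
  have pos: "?a > 0" "?b > 0" by (simp_all add: add_nonneg_pos)
  have "(?a - 2) / ?a = (?b - 2) / ?b" using assms by simp
  then have ab: "?a = ?b" using pos by (simp add: field_simps)
  have "(2 / ?a) *\<^sub>R z = (2 / ?b) *\<^sub>R w" using assms by simp
  then have "(2 / ?a) *\<^sub>R z = (2 / ?a) *\<^sub>R w" by (simp only: ab)
  moreover have "2 / ?a \<noteq> 0" using pos by simp
  ultimately show ?thesis by (metis scaleR_cancel_left)
qed

lemma stereo_inj: "stereo x = stereo y \<longleftrightarrow> x = y"
proof
  assume eq: "stereo x = stereo y"
  show "x = y"
  proof (cases x; cases y)
    fix z w assume "x = Fin z" "y = Fin w"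
    then show ?thesis using eq stereo_Fin_inj by blast
  next
    fix z assume "x = Fin z" "y = Infty"
    then show ?thesis using eq stereo_snd_less[of z] by (metis less_irrefl snd_conv stereo.simps(2))
  next
    fix w assume "x = Infty" "y = Fin w"
    then show ?thesis using eq stereo_snd_less[of w] by (metis less_irrefl snd_conv stereo.simps(2))
  qed simp
qed simp

instantiation rsphere :: metric_space
begin

definition dist_rsphere :: "rsphere \<Rightarrow> rsphere \<Rightarrow> real" where
  "dist_rsphere x y = dist (stereo x) (stereo y)"

definition uniformity_rsphere :: "(rsphere \<times> rsphere) filter" where
  "uniformity_rsphere = (INF e\<in>{0<..}. principal {(x, y). dist x y < e})"

definition open_rsphere :: "rsphere set \<Rightarrow> bool" where
  "open_rsphere U \<longleftrightarrow> (\<forall>x\<in>U. eventually (\<lambda>(x', y). x' = x \<longrightarrow> y \<in> U) uniformity)"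

instance
proof
  fix x y z :: rsphere
  show "dist x y = 0 \<longleftrightarrow> x = y"
    by (simp add: dist_rsphere_def stereo_inj)
  show "dist x y \<le> dist x z + dist y z"
    by (simp add: dist_rsphere_def dist_triangle2)
qed (simp_all add: uniformity_rsphere_def open_rsphere_def)

end

definition normal_on :: "rsphere set \<Rightarrow> (rsphere \<Rightarrow> rsphere) set \<Rightarrow> bool" where
  "normal_on U F \<longleftrightarrow>
     (\<forall>s :: nat \<Rightarrow> rsphere \<Rightarrow> rsphere. (\<forall>k. s k \<in> F) \<longrightarrow>
        (\<exists>r g. strict_mono (r :: nat \<Rightarrow> nat) \<and>
           (\<forall>K. compact K \<and> K \<subseteq> U \<longrightarrow>
              uniform_limit K (\<lambda>k. s (r k)) g sequentially)))"

definition fatou_set :: "(rsphere \<Rightarrow> rsphere) \<Rightarrow> rsphere set" where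
  "fatou_set f = {z. \<exists>U. open U \<and> z \<in> U \<and> normal_on U (range (\<lambda>k. f ^^ k))}"

definition julia_set :: "(rsphere \<Rightarrow> rsphere) \<Rightarrow> rsphere set" where
  "julia_set f = - fatou_set f"

fun sphere_inverse :: "rsphere \<Rightarrow> rsphere" where
  "sphere_inverse (Fin z) = (if z = 0 then Infty else Fin (1 / z))"
| "sphere_inverse Infty = Fin 0"

text \<open>Holomorphy of a map from a plane open set into the sphere: locally, in one
  of the two standard charts \<open>z\<close> and \<open>1/z\<close>, it is an ordinary
  holomorphic function.\<close>

definition sphere_holomorphic_on :: "(complex \<Rightarrow> rsphere) \<Rightarrow> complex set \<Rightarrow> bool" where
  "sphere_holomorphic_on \<phi> A \<longleftrightarrow>
     (\<forall>z\<in>A. \<exists>V g. open V \<and> z \<in> V \<and> V \<subseteq> A \<and> g holomorphic_on V \<and>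
        ((\<forall>w\<in>V. \<phi> w = Fin (g w)) \<or> (\<forall>w\<in>V. \<phi> w = sphere_inverse (Fin (g w)))))"

text \<open>A Fatou component on which some iterate is conformally conjugate to an
  irrational rotation of a round annulus. An injective holomorphic map is
  conformal onto its image, so nothing is required of the inverse of \<open>\<phi>\<close>;
  the conjugacy equation makes \<open>U\<close> invariant under \<open>f ^^ p\<close>.\<close>

definition herman_ring :: "(rsphere \<Rightarrow> rsphere) \<Rightarrow> rsphere set \<Rightarrow> bool" where
  "herman_ring f U \<longleftrightarrow>
     U \<in> components (fatou_set f) \<and>
     (\<exists>(p::nat) (R::real) (\<theta>::real) \<phi>. p \<ge> 1 \<and> R > 1 \<and> \<theta> \<notin> \<rat> \<and>
        (let A = {z::complex. 1 < cmod z \<and> cmod z < R} in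
           sphere_holomorphic_on \<phi> A \<and> inj_on \<phi> A \<and> \<phi> ` A = U \<and>
           (\<forall>z\<in>A. (f ^^ p) (\<phi> z) = \<phi> (cis (2 * pi * \<theta>) * z))))"

fun cantor_level :: "nat \<Rightarrow> real set" where
  "cantor_level 0 = {0..1}"
| "cantor_level (Suc k) =
     (\<lambda>x. x / 3) ` cantor_level k \<union> (\<lambda>x. (x + 2) / 3) ` cantor_level k"

definition middle_third_cantor_set :: "real set" where
  "middle_third_cantor_set = (\<Inter>k. cantor_level k)"

definition closed_jordan_curve :: "'a::topological_space set \<Rightarrow> bool" where
  "closed_jordan_curve J \<longleftrightarrow>
     (\<exists>\<gamma>. simple_path \<gamma> \<and> pathfinish \<gamma> = pathstart \<gamma> \<and> path_image \<gamma> = J)"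

definition cantor_set_of_circles :: "rsphere set \<Rightarrow> bool" where
  "cantor_set_of_circles S \<longleftrightarrow>
     (\<exists>\<J>. uncountable \<J> \<and> disjoint \<J> \<and> (\<forall>J\<in>\<J>. closed_jordan_curve J) \<and> \<Union>\<J> = S) \<and>
     S homeomorphic (middle_third_cantor_set \<times> sphere (0::complex) 1)"

fun carpet_level :: "nat \<Rightarrow> (real \<times> real) set" where
  "carpet_level 0 = {0..1} \<times> {0..1}"
| "carpet_level (Suc k) =
     (\<Union>(i, j) \<in> {0, 1, 2} \<times> {0, 1, 2} - {(1, 1)}.
        (\<lambda>(x, y). ((x + i) / 3, (y + j) / 3)) ` carpet_level k)"

definition sierpinski_carpet :: "(real \<times> real) set" where
  "sierpinski_carpet = (\<Inter>k. carpet_level k)"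

text \<open>A set homeomorphic to the carpet is never the whole sphere, so a subset of the
  sphere satisfying this can be moved into the plane by a rotation; planarity needs
  no separate clause.\<close>

definition sierpinski_curve :: "rsphere set \<Rightarrow> bool" where
  "sierpinski_curve S \<longleftrightarrow> S homeomorphic sierpinski_carpet"

text \<open>At the poles, the roots of \<open>z ^ n = c\<close>, the numerator
  \<open>c\<^sup>2\<close> does not vanish when \<open>c \<noteq> 0\<close>, and for
  \<open>n \<ge> 1\<close> the map tends to \<open>Infty\<close> at \<open>Infty\<close>; so under these
  conditions this is the extension to the sphere.\<close>

fun f_map :: "nat \<Rightarrow> complex \<Rightarrow> rsphere \<Rightarrow> rsphere" where
  "f_map n c (Fin z) =
     (if z ^ n = c then Infty else Fin (z ^ n + c\<^sup>2 / (z ^ n - c)))"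
| "f_map n c Infty = Infty"

end

theory Submission imports Defs begin

text \<open>
  The Fatou set contains a connected, completely invariant open set \<open>\<Omega>\<close>, the basin of \<open>- c\<close> or
  of infinity according to the size of \<open>cmod c ^ (n - 1) * 3 ^ n\<close>. By Montel's theorem the
  iterates are normal off the closure of \<open>\<Omega>\<close>, so the Julia set lies in the frontier of the single
  domain \<open>\<Omega>\<close>. A Jordan curve in this frontier has a side missing the frontier, and these sides are
  disjoint for different curves, so the curves form a countable family when they are disjoint; by
  Janiszewski's theorem the frontier contains no theta curve, whereas the carpet does. Finally,
  a Herman ring cannot be \<open>\<Omega>\<close>, because \<open>f\<close> is not injective there, and a side of its core curve
  that misses \<open>\<Omega>\<close> would be contained in the ring.\<close>


section \<open>The sphere\<close>

text \<open>The free critical values explain the constants. Write \<open>F z\<close> as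
  \<open>P (z ^ n)\<close> with \<open>P u = u + c\<^sup>2 / (u - c)\<close>; the critical points of
  \<open>P\<close> are \<open>0\<close> and \<open>2 * c\<close>, with values \<open>- c\<close> and
  \<open>3 * c\<close>. Small \<open>c\<close> makes a disc around 0 that contains
  \<open>- c\<close> invariant; large \<open>c\<close> makes \<open>3 * c\<close> escape, because
  then \<open>(3 * cmod c) ^ (n - 1)\<close> is at least \<open>5/3\<close>. The bound
  \<open>5\<close> is a value at which both estimates still hold, so the two cases leave no gap.
  Backward invariance of \<Omega> is what lets the elementary Montel theorem for bounded families
  suffice: orbits of points off the closure never enter \<Omega>, hence stay away from 0 (small
  \<open>c\<close>) or from infinity (large \<open>c\<close>), and so are bounded in the chart
  \<open>1/z\<close> or \<open>z\<close>. Only the inclusion of the Julia set in the frontier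
  matters. The obstructions concern arbitrary subsets of the frontier of one plane domain, so
  neither the exact Julia set nor the other Fatou components have to be described.\<close>

abbreviation Inv :: "complex \<Rightarrow> rsphere" where
  "Inv w \<equiv> sphere_inverse (Fin w)"

lemma dist_Fin_Fin_sq:
  "(dist (Fin z) (Fin w))\<^sup>2 = 4 * (cmod (z - w))\<^sup>2 / (((cmod z)\<^sup>2 + 1) * ((cmod w)\<^sup>2 + 1))"
proof -
  define a b where "a = (cmod z)\<^sup>2 + 1" and "b = (cmod w)\<^sup>2 + 1"
  have pos: "a > 0" "b > 0" by (simp_all add: a_def b_def add_nonneg_pos)
  have sz: "(Re z)\<^sup>2 = a - 1 - (Im z)\<^sup>2" and sw: "(Re w)\<^sup>2 = b - 1 - (Im w)\<^sup>2"
    by (simp_all add: a_def b_def cmod_power2)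
  have "(dist (Fin z) (Fin w))\<^sup>2 =
     (2 / a * Re z - 2 / b * Re w)\<^sup>2 + (2 / a * Im z - 2 / b * Im w)\<^sup>2 + ((a - 2) / a - (b - 2) / b)\<^sup>2"
    by (simp add: dist_rsphere_def norm_Pair a_def b_def dist_norm cmod_power2)
  also have "\<dots> = 4 * ((Re z - Re w)\<^sup>2 + (Im z - Im w)\<^sup>2) / (a * b)"
    using pos by (simp add: field_simps power2_eq_square) (use sz sw in algebra)
  finally show ?thesis by (simp add: a_def b_def cmod_power2)
qed

lemma dist_Fin_Infty_sq: "(dist (Fin z) Infty)\<^sup>2 = 4 / ((cmod z)\<^sup>2 + 1)"
proof -
  define a where "a = (cmod z)\<^sup>2 + 1"
  have pos: "a > 0" by (simp add: a_def add_nonneg_pos)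
  have sz: "(cmod z)\<^sup>2 = a - 1" 
    by (simp add: a_def)
  have "(dist (Fin z) Infty)\<^sup>2 = (2 / a * cmod z)\<^sup>2 + ((a - 2) / a - 1)\<^sup>2"
    by (simp add: dist_rsphere_def norm_Pair a_def dist_norm add_nonneg_nonneg)
  also have "\<dots> = 4 / a"
    using pos by (simp add: field_simps power2_eq_square) (use sz in algebra)
  finally show ?thesis by (simp add: a_def)
qed

lemma dist_Fin_Infty_le: "z \<noteq> 0 \<Longrightarrow> dist (Fin z) Infty \<le> 2 / cmod z"
proof -
  assume "z \<noteq> 0"
  then have "(dist (Fin z) Infty)\<^sup>2 \<le> (2 / cmod z)\<^sup>2"
    unfolding dist_Fin_Infty_sq by (simp add: power_divide frac_le)
  then show ?thesis by (rule power2_le_imp_le) simp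
qed

lemma dist_Fin_le: "dist (Fin z) (Fin w) \<le> 2 * dist z w"
proof -
  have "1 \<le> ((cmod z)\<^sup>2 + 1) * ((cmod w)\<^sup>2 + 1)"
    by (rule mult_ge1_I) auto
  then have "(dist (Fin z) (Fin w))\<^sup>2 \<le> 4 * (cmod (z - w))\<^sup>2"
    unfolding dist_Fin_Fin_sq by (simp add: divide_le_eq mult_le_cancel_left1)
  then have "(dist (Fin z) (Fin w))\<^sup>2 \<le> (2 * dist z w)\<^sup>2"
    by (simp add: dist_norm power_mult_distrib)
  then show ?thesis by (rule power2_le_imp_le) simp
qed

lemma sphere_inverse_inverse [simp]: "sphere_inverse (sphere_inverse x) = x"
  by (cases x) auto

text \<open>Inversion is the half-turn of the unit sphere about the real axis, hence an isometry.
  All estimates for the chart \<open>Inv\<close> at infinity are therefore inherited from those for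
  \<open>Fin\<close>.\<close>

lemma stereo_sphere_inverse:
  "stereo (sphere_inverse x) = (cnj (fst (stereo x)), - snd (stereo x))"
proof (cases x)
  case (Fin z)
  show ?thesis
  proof (cases "z = 0")
    case False
    then have p: "(cmod z)\<^sup>2 > 0" "1 + (cmod z)\<^sup>2 \<noteq> 0" by (auto simp: add_nonneg_eq_0_iff)
    have "1 / z = cnj z / of_real ((cmod z)\<^sup>2)"
      using False by (simp add: complex_norm_square divide_simps del: of_real_power)
    then have "(2 / ((cmod (1/z))\<^sup>2 + 1)) *\<^sub>R (1/z) = (2 / ((cmod z)\<^sup>2 + 1)) *\<^sub>R cnj z"
      using p by (simp add: scaleR_conv_of_real norm_divide power_divide field_simps add_eq_0_iff
          flip: of_real_power)
    moreover have "((cmod (1/z))\<^sup>2 - 1) / ((cmod (1/z))\<^sup>2 + 1) = - (((cmod z)\<^sup>2 - 1) / ((cmod z)\<^sup>2 + 1))"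
    proof -
      have "(1 / t - 1) / (1 / t + 1) = - ((t - 1) / (t + 1))" if "t > 0" for t :: real
        using that by (simp add: divide_simps)
      from this[OF p(1)] show ?thesis by (simp add: norm_divide power_divide)
    qed
    ultimately show ?thesis using Fin False by simp
  qed (simp add: Fin)
qed simp

lemma dist_sphere_inverse [simp]: "dist (sphere_inverse x) (sphere_inverse y) = dist x y"
proof -
  have "dist (cnj a) (cnj b) = dist a b" for a b
    by (metis complex_cnj_diff complex_mod_cnj dist_norm)
  then show ?thesis
    by (cases "stereo x"; cases "stereo y")
      (simp add: dist_rsphere_def stereo_sphere_inverse dist_Pair_Pair dist_minus)
qed

lemma continuous_on_sphere_inverse: "continuous_on A sphere_inverse"
  unfolding continuous_on_iff by auto

lemma dist_Inv_le: "dist (Inv z) (Inv w) \<le> 2 * dist z w"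
  unfolding dist_sphere_inverse by (rule dist_Fin_le)

lemma continuous_on_lipschitz2:
  fixes h :: "'a::metric_space \<Rightarrow> 'b::metric_space"
  assumes "\<And>z w. dist (h z) (h w) \<le> 2 * dist z w"
  shows "continuous_on A h"
  unfolding continuous_on_iff
proof (intro ballI allI impI)
  fix x e :: _ assume "x \<in> A" "(0::real) < e"
  from this(2) show "\<exists>d>0. \<forall>x'\<in>A. dist x' x < d \<longrightarrow> dist (h x') (h x) < e"
  proof (intro exI[of _ "e / 2"] conjI ballI impI)
    fix x' assume "dist x' x < e / 2"
    then show "dist (h x') (h x) < e" using assms[of x' x] by linarith
  qed simp
qed

lemma continuous_on_Fin: "continuous_on A Fin"
  by (rule continuous_on_lipschitz2) (rule dist_Fin_le)

lemma continuous_on_Inv: "continuous_on A Inv"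
  by (rule continuous_on_lipschitz2) (rule dist_Inv_le)

lemma inj_Inv: "inj Inv"
  by (metis injI rsphere.inject sphere_inverse_inverse)

lemma continuous_on_stereo: "continuous_on A stereo"
  unfolding continuous_on_iff dist_rsphere_def by auto

lemma continuous_on_inv_open_map:
  assumes "inj h" "\<And>U. open U \<Longrightarrow> open (h ` U)"
  shows "continuous_on (range h) (inv h)"
  unfolding continuous_on_open_invariant
proof (intro allI impI)
  fix B :: "'a set" assume "open B"
  moreover have "h ` B \<inter> range h = inv h -` B \<inter> range h"
    using assms(1) by (auto dest: injD)
  ultimately show "\<exists>A. open A \<and> A \<inter> range h = inv h -` B \<inter> range h"
    using assms(2) by blast
qed

lemma open_Compl_Infty: "open (- {Infty})"
  by (rule open_Compl) simp

lemma open_image_Fin: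
  assumes "open U" shows "open (Fin ` U)"
proof -
  \<comment> \<open>Stereographic projection from the north pole, a left inverse of
    \<open>Fin\<close> that is continuous off \<open>Infty\<close>; the image under
    \<open>Fin\<close> thus becomes a preimage under \<open>g\<close>.\<close>
  define g where "g x = (1 / (1 - snd (stereo x))) *\<^sub>R fst (stereo x)" for x
  have g: "g (Fin z) = z" for z
  proof -
    have pos: "(cmod z)\<^sup>2 + 1 > 0" by (simp add: add_nonneg_pos)
    then have "1 - snd (stereo (Fin z)) = 2 / ((cmod z)\<^sup>2 + 1)" by (simp add: field_simps)
    then have gz: "g (Fin z) = (1 / (2 / ((cmod z)\<^sup>2 + 1))) *\<^sub>R (2 / ((cmod z)\<^sup>2 + 1)) *\<^sub>R z"
      by (simp add: g_def)
    note gz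
    also have "\<dots> = z"
    proof -
      have "1 / (2 / t) * (2 / t) = 1" if "t > 0" for t :: real using that by simp
      from this[OF pos] show ?thesis unfolding scaleR_scaleR by (simp only: scaleR_one)
    qed
    finally show ?thesis .
  qed
  have "continuous_on (- {Infty}) g"
    unfolding g_def
  proof (intro continuous_intros continuous_on_stereo ballI)
    fix x assume "x \<in> - {Infty}"
    then show "1 - snd (stereo x) \<noteq> 0"
    proof (cases x)
      case (Fin z)
      then show ?thesis using stereo_snd_less[of z] by (simp del: stereo.simps)
    qed simp
  qed
  then have "open (g -` U \<inter> - {Infty})"
    using assms open_Compl_Infty by (metis continuous_on_open_vimage)
  also have "g -` U \<inter> - {Infty} = Fin ` U"
  proof -
    have "x \<in> g -` U \<inter> - {Infty} \<longleftrightarrow> x \<in> Fin ` U" for x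
      by (cases x) (auto simp: g)
    then show ?thesis by blast
  qed
  finally show ?thesis .
qed

lemma open_image_Inv:
  assumes "open U" shows "open (Inv ` U)"
proof -
  have "open (sphere_inverse -` (Fin ` U))"
    using continuous_on_sphere_inverse[of UNIV] open_image_Fin[OF assms]
    by (simp add: continuous_on_open_vimage)
  also have "sphere_inverse -` (Fin ` U) = Inv ` U"
  proof -
    have "x \<in> sphere_inverse -` (Fin ` U) \<longleftrightarrow> x \<in> Inv ` U" for x
      unfolding vimage_def image_iff mem_Collect_eq by (metis sphere_inverse_inverse)
    then show ?thesis by blast
  qed
  finally show ?thesis .
qed

lemma open_insert_Infty:
  assumes "open A" "\<And>z. cmod z > R \<Longrightarrow> z \<in> A"
  shows "open (insert Infty (Fin ` A))"
proof -
  \<comment> \<open>\<open>R\<close> may be zero or negative; the maximum keeps the radius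
    \<open>1 / S\<close> of the disc around infinity positive.\<close>
  define S where "S = max R 1"
  have "insert Infty (Fin ` A) = Fin ` A \<union> Inv ` ball 0 (1 / S)"
  proof -
    have "Inv w \<in> insert Infty (Fin ` A)" if "w \<in> ball 0 (1 / S)" for w
    proof (cases "w = 0")
      case False
      have "S > 0" by (simp add: S_def)
      then have "S < 1 / cmod w" using that False by (simp add: field_simps)
      then have "R < cmod (1 / w)" by (simp add: S_def norm_divide)
      then show ?thesis using False assms by auto
    qed simp
    moreover have "Infty \<in> Inv ` ball 0 (1 / S)"
      by (rule image_eqI[of _ _ 0]) (auto simp: S_def)
    ultimately show ?thesis by blast
  qed
  then show ?thesis using open_image_Fin[OF assms(1)] open_image_Inv by auto
qed

lemma compact_UNIV_rsphere: "compact (UNIV :: rsphere set)"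
proof -
  have "x \<in> Fin ` cball 0 1 \<union> Inv ` cball 0 1" for x
  proof (cases x)
    case (Fin z)
    show ?thesis
    proof (cases "cmod z \<le> 1")
      case False
      then have "x = Inv (1 / z)" "1 / z \<in> cball 0 1" using Fin by (auto simp: norm_divide divide_simps)
      then show ?thesis by blast
    qed (use Fin in auto)
  next
    case Infty
    then have "x = Inv 0" by simp
    then show ?thesis by force
  qed
  then have "UNIV = Fin ` cball 0 1 \<union> Inv ` cball 0 1" by blast
  then show ?thesis
    by (metis compact_Un compact_continuous_image compact_cball continuous_on_Fin continuous_on_Inv)
qed


section \<open>Criteria for normality of iterates\<close>

text \<open>A sequence of iterates either repeats one exponent infinitely often, and then has a
  constant subsequence, or takes each exponent finitely often, and then has a subsequence with
  increasing exponents. Only the latter kind needs an argument in the applications.\<close>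

lemma normal_on_iterates:
  assumes "\<And>m :: nat \<Rightarrow> nat. strict_mono m \<Longrightarrow>
     \<exists>r g. strict_mono (r :: nat \<Rightarrow> nat) \<and>
       (\<forall>K. compact K \<and> K \<subseteq> U \<longrightarrow> uniform_limit K (\<lambda>k. f ^^ m (r k)) g sequentially)"
  shows "normal_on U (range (\<lambda>k. f ^^ k))"
  unfolding normal_on_def
proof (intro allI impI)
  fix s :: "nat \<Rightarrow> rsphere \<Rightarrow> rsphere"
  assume "\<forall>k. s k \<in> range (\<lambda>k. f ^^ k)"
  then have "\<forall>k. \<exists>m. s k = f ^^ m" by blast
  then obtain m where m: "\<And>k. s k = f ^^ m k" by metis
  show "\<exists>r g. strict_mono (r :: nat \<Rightarrow> nat) \<and>
          (\<forall>K. compact K \<and> K \<subseteq> U \<longrightarrow> uniform_limit K (\<lambda>k. s (r k)) g sequentially)"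
  proof (cases "\<exists>j. infinite {k. m k = j}")
    case True
    then obtain j where "infinite {k. m k = j}" by blast
    then obtain r :: "nat \<Rightarrow> nat" where r: "strict_mono r" "\<And>k. r k \<in> {k. m k = j}"
      using infinite_enumerate by blast
    then have "uniform_limit K (\<lambda>k. s (r k)) (f ^^ j) sequentially" for K
      by (simp add: m uniform_limit_iff)
    then show ?thesis using r(1) by blast
  next
    case False
    have ev: "\<exists>k>k0. m k > j" for k0 j
    proof -
      have "{k. m k \<le> j} = (\<Union>i\<le>j. {k. m k = i})" by auto
      then have "finite ({k. m k \<le> j} \<union> {..k0})" using False by simp
      then obtain k where "k \<notin> {k. m k \<le> j} \<union> {..k0}"
        using ex_new_if_finite infinite_UNIV_nat by blast
      then show ?thesis by (auto simp: not_le)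
    qed
    \<comment> \<open>Greedy choice: each step increases the position in the sequence and the
      exponent at that position together.\<close>
    define q where "q = rec_nat 0 (\<lambda>_ k0. SOME k. k > k0 \<and> m k > m k0)"
    have q: "q (Suc i) > q i \<and> m (q (Suc i)) > m (q i)" for i
      unfolding q_def using someI_ex[OF ev[of "q i" "m (q i)", unfolded q_def]] by simp
    then have "strict_mono q" "strict_mono (m \<circ> q)"
      by (simp_all add: strict_mono_Suc_iff)
    from assms[OF this(2)] obtain r g where r: "strict_mono (r :: nat \<Rightarrow> nat)"
      "\<And>K. compact K \<and> K \<subseteq> U \<Longrightarrow> uniform_limit K (\<lambda>k. f ^^ (m \<circ> q) (r k)) g sequentially" by blast
    have "strict_mono (q \<circ> r)" using \<open>strict_mono q\<close> r(1) by (rule strict_mono_o)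
    moreover have "\<forall>K. compact K \<and> K \<subseteq> U \<longrightarrow> uniform_limit K (\<lambda>k. s ((q \<circ> r) k)) g sequentially"
      using r(2) by (simp add: m)
    ultimately show ?thesis by blast
  qed
qed

lemma fatou_set_vimage:
  assumes "continuous_on UNIV f" "f x \<in> fatou_set f"
  shows "x \<in> fatou_set f"
proof -
  from assms(2) obtain V where V: "open V" "f x \<in> V" "normal_on V (range (\<lambda>k. f ^^ k))"
    by (auto simp: fatou_set_def)
  have "open (f -` V)" using assms(1) V(1) by (simp add: continuous_on_open_vimage)
  moreover have "normal_on (f -` V) (range (\<lambda>k. f ^^ k))"
  proof (rule normal_on_iterates)
    fix m :: "nat \<Rightarrow> nat" assume m: "strict_mono m"
    \<comment> \<open>One application of \<open>f\<close> is split off from each iterate. The shift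
      to \<open>m (Suc k)\<close> ensures that the exponent is at least 1, so that the natural
      subtraction is genuine.\<close>
    obtain r g where r: "strict_mono (r :: nat \<Rightarrow> nat)"
      "\<And>K. compact K \<Longrightarrow> K \<subseteq> V \<Longrightarrow> uniform_limit K (\<lambda>k. f ^^ (m (Suc (r k)) - 1)) g sequentially"
      using V(3) unfolding normal_on_def
      by (elim allE[of _ "\<lambda>k. f ^^ (m (Suc k) - 1)"]) auto
    have "strict_mono (Suc \<circ> r)" using r(1) by (simp add: strict_mono_def)
    moreover have "uniform_limit K (\<lambda>k. f ^^ m ((Suc \<circ> r) k)) (g \<circ> f) sequentially"
      if K: "compact K \<and> K \<subseteq> f -` V" for K
    proof -
      have "compact (f ` K)"
        using K assms(1) by (meson compact_continuous_image continuous_on_subset subset_UNIV)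
      moreover have "f ` K \<subseteq> V" using K by blast
      ultimately have ul: "uniform_limit (f ` K) (\<lambda>k. f ^^ (m (Suc (r k)) - 1)) g sequentially"
        by (rule r(2))
      have "f ^^ m (Suc i) = (f ^^ (m (Suc i) - 1)) \<circ> f" for i
      proof -
        have "m (Suc i) > m i" using m by (simp add: strict_mono_def)
        then show ?thesis by (metis Suc_diff_1 funpow_Suc_right gr_zeroI not_less_zero)
      qed
      then show ?thesis using ul by (simp add: uniform_limit_iff)
    qed
    ultimately show "\<exists>r g. strict_mono (r :: nat \<Rightarrow> nat) \<and>
       (\<forall>K. compact K \<and> K \<subseteq> f -` V \<longrightarrow> uniform_limit K (\<lambda>k. f ^^ m (r k)) g sequentially)"
      by blast
  qed
  ultimately show ?thesis using V(2) by (auto simp: fatou_set_def)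
qed

text \<open>Moduli grow at least like \<open>\<kappa> ^ k * R\<close>, and the chordal distance to
  \<open>Infty\<close> is at most 2 divided by the modulus. So the iterates converge to
  \<open>Infty\<close> uniformly, without passing to a subsequence.\<close>

lemma escape_subset_fatou_set:
  assumes R: "R > 0" "\<kappa> > 1"
    and Infty: "f Infty = Infty"
    and esc: "\<And>z. cmod z \<ge> R \<Longrightarrow> \<exists>y. f (Fin z) = Fin y \<and> cmod y \<ge> \<kappa> * cmod z"
  shows "insert Infty (Fin ` {z. cmod z > R}) \<subseteq> fatou_set f"
proof -
  have iter: "\<exists>y. (f ^^ k) (Fin z) = Fin y \<and> cmod y \<ge> \<kappa> ^ k * R" if "cmod z > R" for k z
  proof (induction k)
    case (Suc k)
    then obtain y where y: "(f ^^ k) (Fin z) = Fin y" "cmod y \<ge> \<kappa> ^ k * R" by blast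
    moreover have "\<kappa> ^ k * R \<ge> R" using R by simp
    ultimately obtain y' where y': "f (Fin y) = Fin y'" "cmod y' \<ge> \<kappa> * cmod y"
      using esc[of y] by auto
    have "\<kappa> * cmod y \<ge> \<kappa> * (\<kappa> ^ k * R)" using y(2) R by simp
    then show ?case using y y' by (simp add: mult.assoc)
  qed (use that in auto)
  have Infty_iter: "(f ^^ k) Infty = Infty" for k by (induction k) (simp_all add: Infty)
  let ?U = "insert Infty (Fin ` {z. cmod z > R})"
  have "normal_on ?U (range (\<lambda>k. f ^^ k))"
  proof (rule normal_on_iterates)
    fix m :: "nat \<Rightarrow> nat" assume m: "strict_mono m"
    have lim: "(\<lambda>k. 2 / (\<kappa> ^ m k * R)) \<longlonglongrightarrow> 0"
    proof -
      have "(\<lambda>k. (2 / R) * (1 / \<kappa>) ^ k) \<longlonglongrightarrow> 0"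
        using R by (intro tendsto_mult_right_zero LIMSEQ_power_zero) simp
      from LIMSEQ_subseq_LIMSEQ[OF this m] show ?thesis
        by (simp add: o_def power_divide mult.commute)
    qed
    have "uniform_limit ?U (\<lambda>k. f ^^ m k) (\<lambda>_. Infty) sequentially"
      unfolding uniform_limit_iff
    proof (intro allI impI)
      fix e :: real assume "e > 0"
      with lim have "eventually (\<lambda>k. 2 / (\<kappa> ^ m k * R) < e) sequentially"
        by (rule order_tendstoD(2))
      then show "\<forall>\<^sub>F k in sequentially. \<forall>x\<in>?U. dist ((f ^^ m k) x) Infty < e"
      proof eventually_elim
        case (elim k)
        have "dist ((f ^^ m k) (Fin z)) Infty < e" if z: "cmod z > R" for z
        proof -
          obtain y where y: "(f ^^ m k) (Fin z) = Fin y" "cmod y \<ge> \<kappa> ^ m k * R"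
            using iter[OF z] by blast
          have pos: "\<kappa> ^ m k * R > 0" using R by simp
          then have "y \<noteq> 0" using y(2) by auto
          then have "dist (Fin y) Infty \<le> 2 / cmod y" by (rule dist_Fin_Infty_le)
          also have "\<dots> \<le> 2 / (\<kappa> ^ m k * R)" using y(2) pos by (intro frac_le) auto
          also note elim
          finally show ?thesis by (simp add: y(1))
        qed
        then show ?case using Infty_iter \<open>e > 0\<close> by auto
      qed
    qed
    then have "uniform_limit K (\<lambda>k. f ^^ m (id k)) (\<lambda>_. Infty) sequentially" if "K \<subseteq> ?U" for K
      using uniform_limit_on_subset that by fastforce
    then show "\<exists>r g. strict_mono (r :: nat \<Rightarrow> nat) \<and>
       (\<forall>K. compact K \<and> K \<subseteq> ?U \<longrightarrow> uniform_limit K (\<lambda>k. f ^^ m (r k)) g sequentially)"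
      using strict_mono_id by blast
  qed
  moreover have "open ?U"
    by (rule open_insert_Infty[of _ R]) (auto intro!: open_Collect_less continuous_intros)
  ultimately show ?thesis unfolding fatou_set_def by blast
qed

text \<open>\<open>h\<close> is to be \<open>Fin\<close> or \<open>Inv\<close>, so that one proof
  serves both charts. Orbits starting in \<open>S\<close> stay in the bounded set \<open>T\<close>,
  so the iterates of \<open>G\<close> form a bounded holomorphic family on \<open>S\<close>; the
  Lipschitz bound on \<open>h\<close> turns locally uniform convergence in the plane into chordal
  convergence.\<close>

lemma montel_chart:
  fixes h :: "complex \<Rightarrow> rsphere"
  assumes lip: "\<And>z w. dist (h z) (h w) \<le> 2 * dist z w"
    and h_open: "\<And>U. open U \<Longrightarrow> open (h ` U)" and "inj h"
    and G: "G holomorphic_on T" and T: "open T" "bounded T"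
    and conj: "\<And>w. w \<in> T \<Longrightarrow> f (h w) = h (G w)"
    and S: "open S" "\<And>w k. w \<in> S \<Longrightarrow> (G ^^ k) w \<in> T"
  shows "h ` S \<subseteq> fatou_set f"
proof -
  have hol: "(G ^^ k) holomorphic_on S" for k
  proof (induction k)
    case (Suc k)
    have "(G ^^ k) ` S \<subseteq> T" using S(2) by blast
    with Suc G have "(G \<circ> (G ^^ k)) holomorphic_on S"
      by (rule holomorphic_on_compose_gen)
    then show ?case by (simp add: o_def)
  qed (simp add: id_def)
  have conjk: "(f ^^ k) (h w) = h ((G ^^ k) w)" if "w \<in> S" for k w
    by (induction k) (use conj S(2) that in auto)
  obtain B where B: "\<And>w. w \<in> T \<Longrightarrow> cmod w \<le> B" using T(2) by (auto simp: bounded_iff)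
  have "normal_on (h ` S) (range (\<lambda>k. f ^^ k))"
  proof (rule normal_on_iterates)
    fix m :: "nat \<Rightarrow> nat" assume m: "strict_mono m"
    obtain g r where gr: "strict_mono (r :: nat \<Rightarrow> nat)"
       "\<And>K. \<lbrakk>compact K; K \<subseteq> S\<rbrakk> \<Longrightarrow> uniform_limit K ((\<lambda>k. G ^^ m k) \<circ> r) g sequentially"
    proof (rule Montel[of S "range (\<lambda>k. G ^^ m k)" "\<lambda>k. G ^^ m k"])
      show "\<exists>B. \<forall>h\<in>range (\<lambda>k. G ^^ m k). \<forall>z\<in>K. cmod (h z) \<le> B" if "K \<subseteq> S" for K
        using that B S(2) by blast
    qed (use S(1) hol in auto)
    have "uniform_limit K (\<lambda>k. f ^^ m (r k)) (h \<circ> g \<circ> inv h) sequentially"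
      if K: "compact K" "K \<subseteq> h ` S" for K
    proof -
      define L where "L = S \<inter> h -` K"
      have KL: "K = h ` L" using K(2) by (auto simp: L_def)
      have inv: "inv h (h w) = w" for w using \<open>inj h\<close> by simp
      have "continuous_on (range h) (inv h)"
        using \<open>inj h\<close> h_open by (rule continuous_on_inv_open_map)
      then have "continuous_on K (inv h)"
        by (rule continuous_on_subset) (use K(2) in blast)
      then have "compact (inv h ` K)"
        using K(1) by (rule compact_continuous_image)
      moreover have "inv h ` K = L" unfolding KL by (simp add: image_image inv)
      ultimately have "compact L" by simp
      have L: "uniform_limit L ((\<lambda>k. G ^^ m k) \<circ> r) g sequentially"
        by (rule gr(2)) (use \<open>compact L\<close> in \<open>auto simp: L_def\<close>)
      show ?thesis
        unfolding uniform_limit_iff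
      proof (intro allI impI)
        fix e :: real assume "e > 0"
        then have "e / 2 > 0" by simp
        with L have "\<forall>\<^sub>F k in sequentially. \<forall>w\<in>L. dist ((G ^^ m (r k)) w) (g w) < e / 2"
          unfolding uniform_limit_iff o_def by blast
        then show "\<forall>\<^sub>F k in sequentially. \<forall>x\<in>K. dist ((f ^^ m (r k)) x) ((h \<circ> g \<circ> inv h) x) < e"
        proof eventually_elim
          case (elim k)
          show ?case
          proof
            fix x assume "x \<in> K"
            then obtain w where w: "x = h w" "w \<in> L" using KL by blast
            then have "dist ((G ^^ m (r k)) w) (g w) < e / 2" using elim by blast
            then have "dist (h ((G ^^ m (r k)) w)) (h (g w)) < e"
              using lip[of "(G ^^ m (r k)) w" "g w"] by linarith
            then show "dist ((f ^^ m (r k)) x) ((h \<circ> g \<circ> inv h) x) < e"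
              using w conjk by (simp add: L_def inv)
          qed
        qed
      qed
    qed
    then show "\<exists>r g. strict_mono (r :: nat \<Rightarrow> nat) \<and>
       (\<forall>K. compact K \<and> K \<subseteq> h ` S \<longrightarrow> uniform_limit K (\<lambda>k. f ^^ m (r k)) g sequentially)"
      using gr(1) by blast
  qed
  then show ?thesis using h_open[OF S(1)] unfolding fatou_set_def by blast
qed


section \<open>Connectedness of the basin\<close>

lemma ex_chart_ball:
  fixes W :: "rsphere set"
  assumes "open W" "x \<in> W"
  obtains B where "open B" "connected B" "x \<in> B" "B \<subseteq> W"
proof -
  have chart: "\<exists>B. open B \<and> connected B \<and> x \<in> B \<and> B \<subseteq> W"
    if h: "\<And>A. continuous_on A h" "\<And>U. open U \<Longrightarrow> open (h ` U)" "x = h w"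
    for h :: "complex \<Rightarrow> rsphere" and w
  proof -
    have "open (h -` W)" using assms(1) h(1) by (rule open_vimage)
    then obtain e where e: "e > 0" "ball w e \<subseteq> h -` W"
      using assms(2) h(3) by (meson openE vimageI)
    show ?thesis
    proof (intro exI[of _ "h ` ball w e"] conjI)
      show "connected (h ` ball w e)" using h(1) by (intro connected_continuous_image) auto
    qed (use h e in auto)
  qed
  have "\<exists>B. open B \<and> connected B \<and> x \<in> B \<and> B \<subseteq> W"
  proof (cases x)
    case (Fin z)
    then show ?thesis using chart[OF continuous_on_Fin open_image_Fin] by blast
  next
    case Infty
    then show ?thesis using chart[OF continuous_on_Inv open_image_Inv, of 0] by simp
  qed
  then show ?thesis using that by blast
qed

lemma open_connected_component_rsphere:
  fixes W :: "rsphere set"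
  assumes "open W"
  shows "open (connected_component_set W x)"
proof (subst open_subopen, intro ballI)
  fix y assume y: "y \<in> connected_component_set W x"
  then have "y \<in> W" using connected_component_subset by fast
  then obtain B where B: "open B" "connected B" "y \<in> B" "B \<subseteq> W"
    using ex_chart_ball assms by metis
  then have "B \<subseteq> connected_component_set W x"
    using y by (metis connected_component_eq connected_component_maximal)
  then show "\<exists>T. open T \<and> y \<in> T \<and> T \<subseteq> connected_component_set W x" using B by blast
qed

text \<open>Let \<open>W\<close> be a component of the basin that \<open>f\<close> sends into the
  component \<open>\<Omega>\<^sub>0\<close> of \<open>a\<close>. Then \<open>f\<close> maps
  \<open>W\<close> onto \<open>\<Omega>\<^sub>0\<close>, as a proper map between components does, so
  \<open>W\<close> contains a preimage of \<open>a\<close>. By \<open>pre\<close> that preimage is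
  joined to \<open>a\<close> inside the basin, and \<open>W\<close> is
  \<open>\<Omega>\<^sub>0\<close>. Induction on the entry time into \<open>D\<close> reaches every
  component.\<close>

lemma connected_basin:
  fixes f :: "rsphere \<Rightarrow> rsphere"
  defines "\<Omega> D \<equiv> \<Union>k. (f ^^ k) -` D"
  assumes f: "continuous_on UNIV f" "\<And>U. open U \<Longrightarrow> open (f ` U)"
    and D: "open D" "connected D" "f ` D \<subseteq> D" "a \<in> D"
    and pre: "\<And>x. f x = a \<Longrightarrow> \<exists>C. connected C \<and> C \<subseteq> \<Omega> D \<and> x \<in> C \<and> a \<in> C"
  shows "connected (\<Omega> D)"
proof -
  have cont: "continuous_on UNIV (f ^^ k)" for k
    by (induction k) (auto intro: continuous_on_compose2[OF f(1)] simp: id_def)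
  have open_\<Omega>: "open (\<Omega> D)"
    unfolding \<Omega>_def using cont D(1) by (intro open_UN ballI open_vimage)
  have D\<Omega>: "D \<subseteq> \<Omega> D" unfolding \<Omega>_def by (auto intro!: exI[of _ "0::nat"])
  have bwd: "x \<in> \<Omega> D" if "f x \<in> \<Omega> D" for x
  proof -
    from that obtain k where "(f ^^ k) (f x) \<in> D" by (auto simp: \<Omega>_def)
    then have "(f ^^ Suc k) x \<in> D" by (simp only: funpow_Suc_right o_apply)
    then show ?thesis unfolding \<Omega>_def by blast
  qed
  have forw: "f x \<in> \<Omega> D" if x: "x \<in> \<Omega> D" for x
  proof -
    from x obtain k where "(f ^^ k) x \<in> D" by (auto simp: \<Omega>_def)
    then have "f ((f ^^ k) x) \<in> D" using D(3) by blast
    then have "(f ^^ k) (f x) \<in> D" by (simp add: funpow_swap1)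
    then show ?thesis unfolding \<Omega>_def by blast
  qed
  define \<Omega>\<^sub>0 where "\<Omega>\<^sub>0 = connected_component_set (\<Omega> D) a"
  have "x \<in> \<Omega>\<^sub>0" if "(f ^^ k) x \<in> D" for k x
    using that
  proof (induction k arbitrary: x)
    case 0
    then show ?case
      using connected_component_maximal[OF D(4,2) D\<Omega>] by (auto simp: \<Omega>\<^sub>0_def)
  next
    case (Suc k)
    have fx: "f x \<in> \<Omega>\<^sub>0" using Suc.prems by (intro Suc.IH) (simp add: funpow_swap1)
    then have "f x \<in> \<Omega> D" unfolding \<Omega>\<^sub>0_def using connected_component_subset by fast
    then have x: "x \<in> \<Omega> D" by (rule bwd)
    define W where "W = connected_component_set (\<Omega> D) x"
    have W: "open W" "connected W" "x \<in> W" "W \<subseteq> \<Omega> D"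
      using open_connected_component_rsphere[OF open_\<Omega>] x connected_component_subset
      by (auto simp: W_def)
    have "connected (f ` W)" using f(1) W(2)
      by (meson connected_continuous_image continuous_on_subset subset_UNIV)
    then have fW: "f ` W \<subseteq> \<Omega>\<^sub>0"
      using connected_component_maximal[of "f x" "f ` W" "\<Omega> D"] W forw fx
      by (metis (no_types, lifting) \<Omega>\<^sub>0_def connected_component_eq image_eqI image_subsetI subsetD)
    have "compact (closure W)"
      using compact_Int_closed[OF compact_UNIV_rsphere closed_closure] by simp
    then have "compact (f ` closure W)" using f(1)
      by (meson compact_continuous_image continuous_on_subset subset_UNIV)
    then have op: "open (- f ` closure W)" by (simp add: compact_imp_closed open_Compl)
    have cl: "f ` closure W \<inter> \<Omega>\<^sub>0 \<subseteq> f ` W"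
    proof
      fix y assume "y \<in> f ` closure W \<inter> \<Omega>\<^sub>0"
      then obtain x' where x': "x' \<in> closure W" "y = f x'" "y \<in> \<Omega>\<^sub>0" by blast
      then have "x' \<in> \<Omega> D"
        using bwd connected_component_subset unfolding \<Omega>\<^sub>0_def by fast
      define W' where "W' = connected_component_set (\<Omega> D) x'"
      have "open W'" "x' \<in> W'"
        using open_connected_component_rsphere[OF open_\<Omega>] \<open>x' \<in> \<Omega> D\<close> by (auto simp: W'_def)
      then have "W' \<inter> W \<noteq> {}" using x'(1) by (metis open_Int_closure_eq_empty disjoint_iff)
      then have "W' = W" unfolding W_def W'_def
        by (simp add: connected_component_nonoverlap)
      then show "y \<in> f ` W" using \<open>x' \<in> W'\<close> x' by blast
    qed
    have "\<Omega>\<^sub>0 \<subseteq> f ` W"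
    proof (rule ccontr)
      assume "\<not> \<Omega>\<^sub>0 \<subseteq> f ` W"
      then have "- f ` closure W \<inter> \<Omega>\<^sub>0 \<noteq> {}" using cl by blast
      moreover have "f ` W \<inter> \<Omega>\<^sub>0 \<noteq> {}" using fx W(3) by blast
      moreover have "f ` W \<inter> - f ` closure W \<inter> \<Omega>\<^sub>0 = {}"
        using closure_subset[of W] by blast
      moreover have "\<Omega>\<^sub>0 \<subseteq> f ` W \<union> - f ` closure W" using cl by blast
      ultimately show False
        using connectedD[of \<Omega>\<^sub>0 "f ` W" "- f ` closure W"] f(2)[OF W(1)] op
        unfolding \<Omega>\<^sub>0_def by (simp add: connected_connected_component)
    qed
    moreover have "a \<in> \<Omega>\<^sub>0" unfolding \<Omega>\<^sub>0_def using D(4) D\<Omega> by auto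
    ultimately obtain b where b: "b \<in> W" "f b = a" by blast
    obtain C where "connected C" "C \<subseteq> \<Omega> D" "b \<in> C" "a \<in> C" using pre[OF b(2)] by blast
    then have "b \<in> \<Omega>\<^sub>0"
      unfolding \<Omega>\<^sub>0_def by (auto simp: connected_component_def)
    moreover have "connected_component (\<Omega> D) x b" using b(1) by (simp add: W_def)
    ultimately show ?case
      unfolding \<Omega>\<^sub>0_def by (auto intro: connected_component_trans connected_component_sym)
  qed
  then have "\<Omega> D \<subseteq> \<Omega>\<^sub>0" by (auto simp: \<Omega>_def)
  then have "\<Omega> D = \<Omega>\<^sub>0" unfolding \<Omega>\<^sub>0_def using connected_component_subset by fast
  then show ?thesis unfolding \<Omega>\<^sub>0_def by (metis connected_connected_component)
qed

section \<open>Continuity, openness and nonconstancy read off in charts\<close>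

lemma isCont_chart:
  fixes h\<^sub>1 h\<^sub>2 :: "complex \<Rightarrow> rsphere"
  assumes "\<And>U. open U \<Longrightarrow> open (h\<^sub>1 ` U)" "\<And>A. continuous_on A h\<^sub>2"
    and V: "open V" "w \<in> V" "g holomorphic_on V" "\<And>w. w \<in> V \<Longrightarrow> f (h\<^sub>1 w) = h\<^sub>2 (g w)"
  shows "isCont f (h\<^sub>1 w)"
  unfolding continuous_at_open
proof (intro allI impI)
  fix B assume B: "open B \<and> f (h\<^sub>1 w) \<in> B"
  have "continuous_on V (h\<^sub>2 \<circ> g)"
    using V(3) assms(2) by (intro continuous_on_compose holomorphic_on_imp_continuous_on)
  then have "open ((h\<^sub>2 \<circ> g) -` B \<inter> V)" using V(1) B by (metis continuous_on_open_vimage)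
  then have "open (h\<^sub>1 ` ((h\<^sub>2 \<circ> g) -` B \<inter> V))" by (rule assms(1))
  then show "\<exists>S. open S \<and> h\<^sub>1 w \<in> S \<and> (\<forall>x'\<in>S. f x' \<in> B)"
    using V B by (intro exI[of _ "h\<^sub>1 ` ((h\<^sub>2 \<circ> g) -` B \<inter> V)"]) auto
qed

text \<open>Stated at a single point, through the interior of the image, because different points of
  one open set call for different pairs of charts. The assumption \<open>nc\<close> is nonconstancy
  near \<open>w\<close>, as the open mapping theorem requires.\<close>

lemma open_map_chart:
  fixes h\<^sub>1 h\<^sub>2 :: "complex \<Rightarrow> rsphere"
  assumes h\<^sub>1: "\<And>A. continuous_on A h\<^sub>1" and h\<^sub>2: "\<And>U. open U \<Longrightarrow> open (h\<^sub>2 ` U)"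
    and V: "open V" "w \<in> V" "g holomorphic_on V" "\<And>w. w \<in> V \<Longrightarrow> f (h\<^sub>1 w) = h\<^sub>2 (g w)"
    and nc: "\<And>B k. open B \<Longrightarrow> w \<in> B \<Longrightarrow> B \<subseteq> V \<Longrightarrow> \<exists>z\<in>B. g z \<noteq> k"
    and U: "open U" "h\<^sub>1 w \<in> U"
  shows "f (h\<^sub>1 w) \<in> interior (f ` U)"
proof -
  have "open (h\<^sub>1 -` U)" using U(1) h\<^sub>1 by (rule open_vimage)
  then have "open (h\<^sub>1 -` U \<inter> V)" using V(1) by blast
  moreover have "w \<in> h\<^sub>1 -` U \<inter> V" using U V by simp
  ultimately obtain e where e: "e > 0" "ball w e \<subseteq> h\<^sub>1 -` U \<inter> V" by (meson openE)
  have "open (g ` ball w e)"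
  proof (rule open_mapping_thm)
    show "g holomorphic_on ball w e" using V(3) e(2) by (auto intro: holomorphic_on_subset)
    show "\<not> g constant_on ball w e"
      using nc[of "ball w e"] e unfolding constant_on_def by fastforce
  qed auto
  then have "open (h\<^sub>2 ` g ` ball w e)" by (rule h\<^sub>2)
  moreover have "h\<^sub>2 ` g ` ball w e = f ` h\<^sub>1 ` ball w e"
    unfolding image_image using e(2) V(4) by (intro image_cong) auto
  moreover have "f ` h\<^sub>1 ` ball w e \<subseteq> f ` U" using e(2) by blast
  moreover have "f (h\<^sub>1 w) \<in> f ` h\<^sub>1 ` ball w e" using e(1) by simp
  ultimately show ?thesis by (metis interiorI)
qed

text \<open>In each pair of charts the equation "map equals \<open>k\<close>" is quadratic in
  \<open>z ^ n\<close> after clearing denominators. If it held on a nonempty open set, the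
  polynomial would have infinitely many roots; the degrees \<open>2 * n\<close>, \<open>n\<close>
  and 0 are distinct, so all three coefficients would vanish.\<close>

lemma quadratic_power_vanishing:
  fixes \<alpha> \<beta> \<gamma> :: complex
  assumes "n > 0" "open B" "B \<noteq> {}"
    and "\<And>z. z \<in> B \<Longrightarrow> \<alpha> * (z ^ n)\<^sup>2 + \<beta> * z ^ n + \<gamma> = 0"
  shows "\<alpha> = 0 \<and> \<beta> = 0 \<and> \<gamma> = 0"
proof -
  define p where "p = monom \<alpha> (2 * n) + monom \<beta> n + [:\<gamma>:]"
  have "B \<subseteq> {z. poly p z = 0}"
    using assms(4) by (auto simp: p_def poly_monom power_mult[symmetric] mult.commute)
  moreover have "infinite B" using assms(2,3) using finite_imp_not_open by blast
  ultimately have "p = 0" using poly_roots_finite finite_subset by blast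
  then have "coeff p (2 * n) = 0" "coeff p n = 0" "coeff p 0 = 0" by simp_all
  then show ?thesis using assms(1) by (simp add: p_def coeff_pCons split: nat.splits)
qed


section \<open>The family\<close>

locale f_family =
  fixes n :: nat and c :: complex
  assumes n: "n \<ge> 3" and c: "c \<noteq> 0"
begin

text \<open>At a pole, division by zero gives this function the spurious value \<open>c\<close>, so
  it represents the map only where \<open>z ^ n \<noteq> c\<close>.\<close>

definition F :: "complex \<Rightarrow> complex" where "F z = z ^ n + c\<^sup>2 / (z ^ n - c)"

text \<open>\<open>q\<close> is the numerator of \<open>F\<close>; \<open>G\<close>, with denominator \<open>q'\<close>, is the map in the chart \<open>1/z\<close>.\<close>

definition q :: "complex \<Rightarrow> complex" where "q z = (z ^ n)\<^sup>2 - c * z ^ n + c\<^sup>2"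

definition q' :: "complex \<Rightarrow> complex" where "q' w = 1 - c * w ^ n + c\<^sup>2 * (w ^ n)\<^sup>2"

definition G :: "complex \<Rightarrow> complex" where "G w = (w ^ n - c * (w ^ n)\<^sup>2) / q' w"

lemma f_Fin: "z ^ n \<noteq> c \<Longrightarrow> f_map n c (Fin z) = Fin (F z)"
  by (simp add: F_def)

lemma F_eq: "z ^ n \<noteq> c \<Longrightarrow> F z = q z / (z ^ n - c)"
  by (simp add: F_def q_def divide_simps) (simp add: power2_eq_square algebra_simps)

lemma f_Fin_pole_chart: "q z \<noteq> 0 \<Longrightarrow> f_map n c (Fin z) = Inv ((z ^ n - c) / q z)"
  using F_eq[of z] f_Fin[of z] by (cases "z ^ n = c") (auto simp: divide_simps)

lemma q'_0 [simp]: "q' 0 = 1" using n by (simp add: q'_def power_0_left)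

lemma f_Inv: 
  assumes "q' w \<noteq> 0" shows "f_map n c (Inv w) = Inv (G w)"
proof (cases "w = 0")
  case True
  then show ?thesis using n by (simp add: G_def power_0_left)
next
  case False
  define v where "v = w ^ n"
  have v: "v \<noteq> 0" using False by (simp add: v_def)
  have zn: "(1 / w) ^ n = 1 / v" by (simp add: v_def power_divide)
  show ?thesis
  proof (cases "1 / v = c")
    case True
    then have "v - c * v\<^sup>2 = 0" using v by (simp add: power2_eq_square) (metis v divide_eq_eq mult.assoc mult.commute)
    then have "G w = 0" by (simp add: G_def v_def)
    moreover have "f_map n c (Inv w) = Infty" using False True zn by simp
    ultimately show ?thesis by simp
  next
    case False': False
    then have d: "1 - c * v \<noteq> 0" using v by (auto simp: field_simps)
    then have G0: "G w \<noteq> 0" using assms v by (simp add: G_def v_def[symmetric] power2_eq_square)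
    have qv: "q' w = 1 - c * v + c\<^sup>2 * v\<^sup>2" by (simp add: q'_def v_def)
    have vd: "v - c * v\<^sup>2 = v * (1 - c * v)" by (simp add: algebra_simps power2_eq_square)
    have "1 / v - c = (1 - c * v) / v" using v by (simp add: field_simps)
    then have "F (1 / w) = 1 / v + c\<^sup>2 * v / (1 - c * v)"
      unfolding F_def zn by simp
    also have "\<dots> = q' w / (v * (1 - c * v))"
      unfolding qv using v d by (simp add: divide_simps) algebra
    also have "\<dots> = 1 / G w" unfolding G_def v_def[symmetric] vd by simp
    finally show ?thesis using False False' zn G0 f_Fin[of "1 / w"] by simp
  qed
qed

lemma holomorphic_F: "F holomorphic_on {z. z ^ n \<noteq> c}"
  unfolding F_def by (intro holomorphic_intros) auto

lemma holomorphic_G: "G holomorphic_on {w. q' w \<noteq> 0}"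
  unfolding G_def q'_def by (intro holomorphic_intros) auto

lemma open_power_neq: "open {z. z ^ n \<noteq> c}"
  by (intro open_Collect_neq continuous_intros)

lemma open_q': "open {w. q' w \<noteq> 0}"
  unfolding q'_def by (intro open_Collect_neq continuous_intros)

lemma open_q: "open {w. q w \<noteq> 0}"
  unfolding q_def by (intro open_Collect_neq continuous_intros)

lemma q_pole: "z ^ n = c \<Longrightarrow> q z \<noteq> 0"
  using c by (simp add: q_def power2_eq_square)

lemma holomorphic_H: "(\<lambda>z. (z ^ n - c) / q z) holomorphic_on {z. q z \<noteq> 0}"
  unfolding q_def by (intro holomorphic_intros) auto

lemma F_nonconst:
  assumes "open B" "w \<in> B" "B \<subseteq> {z. z ^ n \<noteq> c}"
  shows "\<exists>z\<in>B. F z \<noteq> k"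
proof (rule ccontr)
  have "B \<noteq> {}" using assms(2) by blast
  assume neg: "\<not> ?thesis"
  then have "1 * (z ^ n)\<^sup>2 + (- c - k) * z ^ n + (c\<^sup>2 + k * c) = 0" if "z \<in> B" for z
  proof -
    have "z ^ n - c \<noteq> 0" "q z / (z ^ n - c) = k" using assms(3) F_eq[of z] that neg by auto
    then have "q z = k * (z ^ n - c)" by (simp add: divide_eq_eq)
    moreover have "x\<^sup>2 - c * x + c\<^sup>2 = k * (x - c) \<Longrightarrow> 1 * x\<^sup>2 + (- c - k) * x + (c\<^sup>2 + k * c) = 0" for x :: complex
      by algebra
    ultimately show ?thesis unfolding q_def by blast
  qed
  then have "(1::complex) = 0 \<and> - c - k = 0 \<and> c\<^sup>2 + k * c = 0"
    using n by (intro quadratic_power_vanishing[OF _ assms(1) \<open>B \<noteq> {}\<close>, of n]) auto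
  then show False by simp
qed

lemma H_nonconst:
  assumes "open B" "w \<in> B" "B \<subseteq> {z. q z \<noteq> 0}"
  shows "\<exists>z\<in>B. (z ^ n - c) / q z \<noteq> k"
proof (rule ccontr)
  have "B \<noteq> {}" using assms(2) by blast
  assume neg: "\<not> ?thesis"
  then have "k * (z ^ n)\<^sup>2 + (- k * c - 1) * z ^ n + (k * c\<^sup>2 + c) = 0" if "z \<in> B" for z
  proof -
    have "q z \<noteq> 0" "(z ^ n - c) / q z = k" using assms(3) that neg by auto
    then have "z ^ n - c = k * q z" by (simp add: divide_eq_eq)
    moreover have "x - c = k * (x\<^sup>2 - c * x + c\<^sup>2) \<Longrightarrow> k * x\<^sup>2 + (- k * c - 1) * x + (k * c\<^sup>2 + c) = 0" for x :: complex
      by algebra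
    ultimately show ?thesis unfolding q_def by blast
  qed
  then have "k = 0 \<and> - k * c - 1 = 0 \<and> k * c\<^sup>2 + c = 0"
    using n by (intro quadratic_power_vanishing[OF _ assms(1) \<open>B \<noteq> {}\<close>, of n]) auto
  then show False by auto
qed

lemma G_nonconst:
  assumes "open B" "w \<in> B" "B \<subseteq> {z. q' z \<noteq> 0}"
  shows "\<exists>z\<in>B. G z \<noteq> k"
proof (rule ccontr)
  have "B \<noteq> {}" using assms(2) by blast
  assume neg: "\<not> ?thesis"
  then have "(k * c\<^sup>2 + c) * (z ^ n)\<^sup>2 + (- k * c - 1) * z ^ n + k = 0" if "z \<in> B" for z
  proof -
    have "q' z \<noteq> 0" "(z ^ n - c * (z ^ n)\<^sup>2) / q' z = k"
      using assms(3) that neg by (auto simp: G_def)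
    then have "z ^ n - c * (z ^ n)\<^sup>2 = k * q' z" by (simp add: divide_eq_eq)
    moreover have "x - c * x\<^sup>2 = k * (1 - c * x + c\<^sup>2 * x\<^sup>2) \<Longrightarrow> (k * c\<^sup>2 + c) * x\<^sup>2 + (- k * c - 1) * x + k = 0" for x :: complex
      by algebra
    ultimately show ?thesis unfolding q'_def by blast
  qed
  then have "k * c\<^sup>2 + c = 0 \<and> - k * c - 1 = 0 \<and> k = 0"
    using n by (intro quadratic_power_vanishing[OF _ assms(1) \<open>B \<noteq> {}\<close>, of n]) auto
  then show False by auto
qed

text \<open>One case for each expression of the map: \<open>F\<close> off the poles, the reciprocal
  of \<open>F\<close> off its zeros, and \<open>G\<close> around infinity. The first two cover the
  plane because numerator and denominator of \<open>F\<close> have no common zero.\<close>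

lemma sphere_cases:
  obtains z where "x = Fin z" "z ^ n \<noteq> c"
  | z where "x = Fin z" "q z \<noteq> 0"
  | "x = Inv 0"
  using q_pole by (cases x) auto

lemma continuous_f: "continuous_on UNIV (f_map n c)"
proof (rule continuous_at_imp_continuous_on, rule ballI)
  fix x
  show "isCont (f_map n c) x"
  proof (cases x rule: sphere_cases)
    case (1 z)
    show ?thesis unfolding 1(1)
      by (rule isCont_chart[where h\<^sub>1 = Fin and h\<^sub>2 = Fin, OF open_image_Fin continuous_on_Fin
            open_power_neq _ holomorphic_F]) (use 1 f_Fin in auto)
  next
    case (2 z)
    show ?thesis unfolding 2(1)
      by (rule isCont_chart[where h\<^sub>1 = Fin and h\<^sub>2 = Inv, OF open_image_Fin continuous_on_Inv
            open_q _ holomorphic_H]) (use 2 f_Fin_pole_chart in auto)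
  next
    case 3
    show ?thesis unfolding 3(1)
      by (rule isCont_chart[where h\<^sub>1 = Inv and h\<^sub>2 = Inv, OF open_image_Inv continuous_on_Inv
            open_q' _ holomorphic_G]) (use 3 f_Inv in auto)
  qed
qed

lemma open_map_f:
  assumes "open U" shows "open (f_map n c ` U)"
proof -
  have "f_map n c x \<in> interior (f_map n c ` U)" if x: "x \<in> U" for x
  proof (cases x rule: sphere_cases)
    case (1 z)
    show ?thesis unfolding 1(1)
      by (rule open_map_chart[where h\<^sub>1 = Fin and h\<^sub>2 = Fin, OF continuous_on_Fin open_image_Fin
            open_power_neq _ holomorphic_F _ F_nonconst]) (use 1 f_Fin assms x in auto)
  next
    case (2 z)
    show ?thesis unfolding 2(1)
      by (rule open_map_chart[where h\<^sub>1 = Fin and h\<^sub>2 = Inv, OF continuous_on_Fin open_image_Inv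
            open_q _ holomorphic_H _ H_nonconst]) (use 2 f_Fin_pole_chart assms x in auto)
  next
    case 3
    show ?thesis unfolding 3(1)
      by (rule open_map_chart[where h\<^sub>1 = Inv and h\<^sub>2 = Inv, OF continuous_on_Inv open_image_Inv
            open_q' _ holomorphic_G _ G_nonconst]) (use 3 f_Inv assms x in auto)
  qed
  then have "f_map n c ` U \<subseteq> interior (f_map n c ` U)" by blast
  then show ?thesis by (metis interior_subset open_interior subset_antisym)
qed

section \<open>The Fatou set near infinity and the two basins\<close>

lemma Infty_in_fatou_set: "Infty \<in> fatou_set (f_map n c)"
proof -
  \<comment> \<open>The summand 3 gives \<open>cmod (z ^ n) \<ge> 9 * cmod z\<close>; the summand
    \<open>2 * cmod c\<close> keeps the denominator above \<open>cmod c\<close>, so that the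
    fraction contributes at most \<open>cmod c\<close>. The bound is needed for every
    \<open>c\<close>, since the Julia set has to lie in the plane in both cases.\<close>
  have "\<exists>y. f_map n c (Fin z) = Fin y \<and> 2 * cmod z \<le> cmod y" if z: "cmod z \<ge> 3 + 2 * cmod c" for z
  proof -
    have z3: "cmod z \<ge> 3" using z by (smt (verit) norm_ge_zero)
    have "cmod z * 3\<^sup>2 \<le> cmod z * cmod z ^ (n - 1)"
    proof (rule mult_left_mono)
      have "(3::real)\<^sup>2 \<le> 3 ^ (n - 1)" using n by (intro power_increasing) auto
      also have "\<dots> \<le> cmod z ^ (n - 1)" using z3 by (intro power_mono) auto
      finally show "3\<^sup>2 \<le> cmod z ^ (n - 1)" .
    qed simp
    also have "\<dots> = cmod (z ^ n)" using n by (simp add: norm_power flip: power_Suc)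
    finally have zn: "cmod (z ^ n) \<ge> 9 * cmod z" by simp
    have d: "cmod (z ^ n - c) \<ge> cmod c"
      using norm_triangle_ineq2[of "z ^ n" c] zn z by (smt (verit) norm_ge_zero)
    have c0: "cmod c > 0" using c by simp
    have "cmod (c\<^sup>2 / (z ^ n - c)) \<le> (cmod c)\<^sup>2 / cmod c"
      unfolding norm_divide norm_power using d c0 by (intro frac_le) auto
    also have "\<dots> = cmod c" by (simp add: power2_eq_square)
    finally have "cmod (F z) \<ge> cmod (z ^ n) - cmod c"
      unfolding F_def using norm_diff_ineq[of "z ^ n" "c\<^sup>2 / (z ^ n - c)"] by linarith
    then have "cmod (F z) \<ge> 2 * cmod z" using zn z by (smt (verit) norm_ge_zero)
    moreover have "z ^ n \<noteq> c" using d c0 by auto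
    ultimately show ?thesis using f_Fin by blast
  qed
  then have "insert Infty (Fin ` {z. cmod z > 3 + 2 * cmod c}) \<subseteq> fatou_set (f_map n c)"
    by (intro escape_subset_fatou_set[where \<kappa> = 2]) (auto simp: add_pos_nonneg)
  then show ?thesis by blast
qed

lemma basin_backward: "f_map n c x \<in> (\<Union>k. (f_map n c ^^ k) -` D) \<Longrightarrow> x \<in> (\<Union>k. (f_map n c ^^ k) -` D)"
proof -
  assume "f_map n c x \<in> (\<Union>k. (f_map n c ^^ k) -` D)"
  then obtain k where "(f_map n c ^^ Suc k) x \<in> D" by (auto simp: funpow_swap1)
  then show ?thesis by blast
qed

lemma basin_subset_fatou_set:
  assumes "D \<subseteq> fatou_set (f_map n c)"
  shows "(\<Union>k. (f_map n c ^^ k) -` D) \<subseteq> fatou_set (f_map n c)"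
proof -
  have "(f_map n c ^^ k) x \<in> D \<Longrightarrow> x \<in> fatou_set (f_map n c)" for k x
  proof (induction k arbitrary: x)
    case (Suc k)
    then have "f_map n c x \<in> fatou_set (f_map n c)" by (simp add: funpow_swap1)
    then show ?case by (rule fatou_set_vimage[OF continuous_f])
  qed (use assms in auto)
  then show ?thesis by blast
qed

lemma open_basin: "open D \<Longrightarrow> open (\<Union>k. (f_map n c ^^ k) -` D)"
proof -
  assume "open D"
  have "continuous_on UNIV (f_map n c ^^ k)" for k
    by (induction k) (auto intro: continuous_on_compose2[OF continuous_f] simp: id_def)
  then show ?thesis using \<open>open D\<close> by (intro open_UN ballI open_vimage)
qed

text \<open>For small \<open>c\<close> the basin is that of the disc of radius \<open>6/5 * cmod c\<close>. It is connected because
  \<open>F z + c = z ^ (2 * n) / (z ^ n - c)\<close>, so that \<open>0\<close> is the only preimage of \<open>- c\<close>.\<close>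

lemma ex_basin_small:
  assumes small: "cmod c ^ (n - 1) * 3 ^ n \<le> 5"
  shows "\<exists>\<Omega>. open \<Omega> \<and> connected \<Omega> \<and> \<Omega> \<subseteq> fatou_set (f_map n c) \<and>
     - closure \<Omega> \<subseteq> fatou_set (f_map n c) \<and> (\<forall>z. cmod z = cmod c \<longrightarrow> Fin z \<in> \<Omega>)"
proof -
  define r where "r = cmod c"
  have r: "r > 0" using c by (simp add: r_def)
  \<comment> \<open>Since \<open>6/5 = (2/5) * 3\<close>, the hypothesis yields
    \<open>cmod (z ^ n) \<le> (8/25) * r\<close>, whence the denominator is at least
    \<open>(17/25) * r\<close>. The distance from \<open>F z\<close> to \<open>- c\<close> is then
    at most \<open>(64/425) * r\<close>, less than the margin \<open>r / 5\<close> between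
    \<open>- c\<close> and the boundary of the disc.\<close>
  have est: "z ^ n \<noteq> c \<and> cmod (F z) < (6/5) * r" if z: "cmod z < (6/5) * r" for z
  proof -
    have "cmod (z ^ n) \<le> ((6/5) * r) ^ n" unfolding norm_power using z by (intro power_mono) auto
    also have "((6/5) * r) ^ n = (2/5) ^ n * (r ^ (n - 1) * 3 ^ n) * r"
    proof -
      have "r ^ n = r ^ (n - 1) * r" using n by (simp flip: power_Suc2)
      moreover have "(6/5 :: real) ^ n = (2/5) ^ n * 3 ^ n" by (simp flip: power_mult_distrib)
      ultimately show ?thesis unfolding power_mult_distrib by (simp only: mult_ac)
    qed
    also have "\<dots> \<le> (2/5) ^ 3 * 5 * r"
    proof (intro mult_right_mono mult_mono)
      show "(2/5 :: real) ^ n \<le> (2/5) ^ 3" using n by (intro power_decreasing) auto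
    qed (use small r in \<open>auto simp: r_def\<close>)
    finally have zn: "cmod (z ^ n) \<le> (8/25) * r" by (simp add: power3_eq_cube)
    then have ne: "z ^ n \<noteq> c" using r by (auto simp: r_def)
    have "cmod (z ^ n - c) \<ge> r - cmod (z ^ n)"
      unfolding r_def using norm_triangle_ineq2[of c "z ^ n"] by (simp add: norm_minus_commute)
    then have d: "cmod (z ^ n - c) \<ge> (17/25) * r" using zn by linarith
    have "F z = - c + (z ^ n)\<^sup>2 / (z ^ n - c)"
      using ne by (simp add: F_eq q_def divide_simps) (simp add: algebra_simps power2_eq_square)
    then have "cmod (F z) \<le> r + cmod ((z ^ n)\<^sup>2 / (z ^ n - c))"
      using norm_triangle_ineq[of "- c"] by (simp add: r_def)
    moreover have "cmod ((z ^ n)\<^sup>2 / (z ^ n - c)) \<le> ((8/25) * r)\<^sup>2 / ((17/25) * r)"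
      unfolding norm_divide norm_power[of "z ^ n"] using zn d r by (intro frac_le power_mono) auto
    moreover have "((8/25) * r)\<^sup>2 / ((17/25) * r) < (1/5) * r"
      using r by (simp add: power2_eq_square field_simps)
    ultimately show ?thesis using ne by linarith
  qed
  define D where "D = Fin ` ball 0 ((6/5) * r)"
  define \<Omega> where "\<Omega> = (\<Union>k. (f_map n c ^^ k) -` D)"
  have D\<Omega>: "D \<subseteq> \<Omega>" unfolding \<Omega>_def by (auto intro!: exI[of _ "0::nat"])
  have "open D" unfolding D_def by (intro open_image_Fin) simp
  have fD: "f_map n c ` D \<subseteq> D"
  proof -
    have "f_map n c (Fin z) \<in> D" if "cmod z < (6/5) * r" for z
      using est[OF that] by (simp add: D_def image_iff f_Fin del: f_map.simps)
    then show ?thesis by (auto simp: D_def simp del: f_map.simps)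
  qed
  have conD: "connected D" unfolding D_def
    by (intro connected_continuous_image continuous_on_Fin) simp
  have "connected \<Omega>" unfolding \<Omega>_def
  proof (rule connected_basin[OF continuous_f open_map_f \<open>open D\<close> conD fD])
    show "Fin (- c) \<in> D" using r by (auto simp: D_def r_def)
    fix x assume x: "f_map n c x = Fin (- c)"
    have "x = Fin 0"
    proof (cases x)
      case (Fin z)
      then have ne: "z ^ n \<noteq> c" and "F z = - c" using x by (auto simp: F_def split: if_splits)
      then have "q z = - c * (z ^ n - c)" by (simp add: F_eq divide_eq_eq)
      then have "(z ^ n)\<^sup>2 = 0" by (simp add: q_def algebra_simps power2_eq_square)
      then show ?thesis using Fin by simp
    qed (use x in auto)
    moreover have "Fin 0 \<in> D" using r by (simp add: D_def)
    ultimately show "\<exists>C. connected C \<and> C \<subseteq> (\<Union>k. (f_map n c ^^ k) -` D) \<and> x \<in> C \<and> Fin (- c) \<in> C"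
      using conD D\<Omega> \<open>Fin (- c) \<in> D\<close> unfolding \<Omega>_def by blast
  qed
  moreover have "D \<subseteq> fatou_set (f_map n c)"
    unfolding D_def
  proof (rule montel_chart[where G = F and T = "ball 0 ((6/5) * r)"])
    show "F holomorphic_on ball 0 ((6/5) * r)"
    proof (rule holomorphic_on_subset[OF holomorphic_F])
      show "ball 0 ((6/5) * r) \<subseteq> {z. z ^ n \<noteq> c}"         using est by (intro subsetI CollectI) (simp add: mem_ball_0)
    qed
    show "(F ^^ k) w \<in> ball 0 ((6/5) * r)" if "w \<in> ball 0 ((6/5) * r)" for w k
      by (induction k) (use that est in auto)
  qed (use est f_Fin open_image_Fin dist_Fin_le in \<open>auto simp: inj_def simp del: f_map.simps\<close>)
  then have "\<Omega> \<subseteq> fatou_set (f_map n c)" unfolding \<Omega>_def by (rule basin_subset_fatou_set)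
  moreover have "- closure \<Omega> \<subseteq> fatou_set (f_map n c)"
  proof -
    define S where "S = Inv -` (- closure \<Omega>)"
    \<comment> \<open>A zero of \<open>q'\<close> is a point that maps to 0, which lies in
      \<open>D\<close>; so \<open>G\<close> is holomorphic off the basin. A point outside
      \<open>D\<close> has \<open>cmod w \<le> 5 / (6 * r)\<close>, and the slack up to
      \<open>1 / r\<close> makes room for an open ball.\<close>
    have nD: "w \<in> {w. q' w \<noteq> 0} \<inter> ball 0 (1 / r)" if w: "Inv w \<notin> \<Omega>" for w
    proof
      have "Inv w \<notin> D" using w D\<Omega> by blast
      have nq: "q' w = 0 \<Longrightarrow> False"
      proof -
        assume 0: "q' w = 0"
        then have w0: "w \<noteq> 0" by auto
        define v where "v = w ^ n"
        have v: "v \<noteq> 0" using w0 by (simp add: v_def)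
        have q'v: "1 - c * v + c\<^sup>2 * v\<^sup>2 = 0" using 0 by (simp add: q'_def v_def)
        have "q (1 / w) = (1 - c * v + c\<^sup>2 * v\<^sup>2) / v\<^sup>2"
          using v by (simp add: q_def power_divide v_def[symmetric] field_simps power2_eq_square)
        then have q0: "q (1 / w) = 0" using q'v by simp
        then have "(1 / w) ^ n \<noteq> c" using q_pole by blast
        then have "f_map n c (Inv w) = Fin 0" using w0 q0 f_Fin[of "1 / w"] F_eq[of "1 / w"] by simp
        then have "f_map n c (Inv w) \<in> \<Omega>" using D\<Omega> r by (auto simp: D_def)
        then show False using basin_backward w unfolding \<Omega>_def by blast
      qed
      then show "w \<in> {w. q' w \<noteq> 0}" by blast
      show "w \<in> ball 0 (1 / r)"
      proof (cases "w = 0")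
        case False
        then have "Fin (1 / w) \<notin> D" using \<open>Inv w \<notin> D\<close> by simp
        then have "1 / cmod w \<ge> (6/5) * r" by (auto simp: D_def norm_divide not_less)
        moreover have "(6/5) * r > r" using r by simp
        ultimately have "1 / cmod w > r" by linarith
        then show ?thesis using r False by (simp add: field_simps)
      qed (use r in simp)
    qed
    have "Inv ` S \<subseteq> fatou_set (f_map n c)"
    proof (rule montel_chart[where G = G and T = "{w. q' w \<noteq> 0} \<inter> ball 0 (1 / r)"])
      show "G holomorphic_on {w. q' w \<noteq> 0} \<inter> ball 0 (1 / r)"
        by (rule holomorphic_on_subset[OF holomorphic_G]) auto
      show "open ({w. q' w \<noteq> 0} \<inter> ball 0 (1 / r))" using open_q' by blast
      show "open S" unfolding S_def by (rule open_vimage[OF _ continuous_on_Inv]) auto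
      show "(G ^^ k) w \<in> {w. q' w \<noteq> 0} \<inter> ball 0 (1 / r)" if "w \<in> S" for w k
      proof -
        have "Inv ((G ^^ k) w) \<notin> \<Omega>"
        proof (induction k)
          case 0
          then show ?case using that closure_subset[of \<Omega>] by (auto simp: S_def simp del: sphere_inverse.simps)
        next
          case (Suc k)
          then have "Inv ((G ^^ Suc k) w) = f_map n c (Inv ((G ^^ k) w))"
            using nD f_Inv by simp
          then show ?case using Suc basin_backward unfolding \<Omega>_def by metis
        qed
        then show ?thesis by (rule nD)
      qed
    qed (use f_Inv open_image_Inv dist_Inv_le inj_Inv in \<open>auto simp del: f_map.simps sphere_inverse.simps\<close>)
    moreover have "- closure \<Omega> \<subseteq> Inv ` S"
    proof
      fix x assume x: "x \<in> - closure \<Omega>"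
      then have "x \<notin> \<Omega>" using closure_subset[of \<Omega>] by blast
      moreover have "Fin 0 \<in> \<Omega>" using D\<Omega> r by (auto simp: D_def)
      ultimately have "x \<noteq> Fin 0" by blast
      then have "\<exists>w. x = Inv w"
      proof (cases x)
        case (Fin z)
        then show ?thesis using \<open>x \<noteq> Fin 0\<close> by (intro exI[of _ "1 / z"]) auto
      qed (auto intro: exI[of _ 0])
      then obtain w where "x = Inv w" by blast
      then show "x \<in> Inv ` S" using x by (auto simp: S_def simp del: sphere_inverse.simps)
    qed
    ultimately show ?thesis by blast
  qed
  \<comment> \<open>A circle around 0 inside the basin will witness that the map is not injective
    there, because rotation by an n-th root of unity preserves the circle and
    \<open>z ^ n\<close>.\<close>
  moreover have "Fin z \<in> \<Omega>" if "cmod z = cmod c" for z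
    using D\<Omega> r that by (auto simp: D_def r_def)
  moreover have "open \<Omega>" unfolding \<Omega>_def using \<open>open D\<close> by (rule open_basin)
  ultimately show ?thesis by blast
qed


text \<open>For large \<open>c\<close> it is the basin of infinity. It is connected because on the ray joining a pole \<open>p\<close>
  to infinity \<open>F (t * p) = (u + 1 / (u - 1)) * c\<close> with \<open>u = t ^ n > 1\<close>, of modulus at least \<open>3 * cmod c\<close>.\<close>

lemma ex_basin_large:
  assumes large: "cmod c ^ (n - 1) * 3 ^ n \<ge> 5"
  shows "\<exists>\<Omega>. open \<Omega> \<and> connected \<Omega> \<and> \<Omega> \<subseteq> fatou_set (f_map n c) \<and>
     - closure \<Omega> \<subseteq> fatou_set (f_map n c) \<and> (\<forall>z. cmod z = 4 * cmod c \<longrightarrow> Fin z \<in> \<Omega>)"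
proof -
  define r where "r = cmod c"
  have r: "r > 0" using c by (simp add: r_def)
  have n1: "(3::real) ^ n = 3 ^ (n - 1) * 3" using n by (simp flip: power_Suc2)
  \<comment> \<open>As \<open>3 ^ n = 3 * 3 ^ (n - 1)\<close>, the hypothesis says
    \<open>(3 * r) ^ (n - 1) \<ge> 5/3\<close>. Hence
    \<open>cmod (z ^ n) \<ge> 5/3 * cmod z \<ge> 5 * r\<close>, the denominator is at least
    \<open>4 * r\<close>, the fraction is at most \<open>r / 4 \<le> cmod z / 12\<close>, and
    \<open>5/3 - 1/12 = 19/12\<close>.\<close>
  have est: "z ^ n \<noteq> c \<and> cmod (F z) \<ge> 19/12 * cmod z" if z: "cmod z \<ge> 3 * r" for z
  proof -
    have "5/3 \<le> (3 * r) ^ (n - 1)" using large unfolding n1 power_mult_distrib r_def by (simp add: mult_ac)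
    also have "\<dots> \<le> cmod z ^ (n - 1)" using z r by (intro power_mono) auto
    finally have "cmod z * (5/3) \<le> cmod z * cmod z ^ (n - 1)" by (intro mult_left_mono) auto
    also have "\<dots> = cmod (z ^ n)" using n by (simp add: norm_power flip: power_Suc)
    finally have zn: "cmod (z ^ n) \<ge> 5/3 * cmod z" by simp
    have d: "cmod (z ^ n - c) \<ge> 4 * r"
      using norm_triangle_ineq2[of "z ^ n" c] zn z unfolding r_def by linarith
    have "cmod (c\<^sup>2 / (z ^ n - c)) \<le> r\<^sup>2 / (4 * r)"
      unfolding norm_divide norm_power r_def[symmetric] using d r by (intro frac_le) auto
    also have "\<dots> = r / 4" by (simp add: power2_eq_square)
    finally have "cmod (F z) \<ge> cmod (z ^ n) - r / 4"
      unfolding F_def using norm_diff_ineq[of "z ^ n" "c\<^sup>2 / (z ^ n - c)"] by linarith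
    then have "cmod (F z) \<ge> 19/12 * cmod z" using zn z by linarith
    moreover have "z ^ n \<noteq> c" using d r by auto
    ultimately show ?thesis by blast
  qed
  define D where "D = insert Infty (Fin ` {z. cmod z > 3 * r})"
  define \<Omega> where "\<Omega> = (\<Union>k. (f_map n c ^^ k) -` D)"
  have D\<Omega>: "D \<subseteq> \<Omega>" unfolding \<Omega>_def by (auto intro!: exI[of _ "0::nat"])
  have f\<Omega>: "x \<in> \<Omega>" if "f_map n c x \<in> \<Omega>" for x
    using basin_backward that unfolding \<Omega>_def by blast
  have "open D" unfolding D_def
    by (rule open_insert_Infty[of _ "3 * r"]) (auto intro!: open_Collect_less continuous_intros)
  have est2: "f_map n c (Fin z) \<in> D" if z: "cmod z \<ge> 3 * r" for z
  proof -
    have "cmod (F z) > 3 * r" using est[OF z] z r by linarith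
    then show ?thesis using est[OF z] f_Fin by (simp add: D_def del: f_map.simps)
  qed
  have fD: "f_map n c ` D \<subseteq> D"
  proof -
    have "f_map n c Infty \<in> D" by (simp add: D_def)
    moreover have "f_map n c (Fin z) \<in> D" if "cmod z > 3 * r" for z using est2 that by simp
    ultimately show ?thesis unfolding D_def by blast
  qed
  have conD: "connected D"
  proof -
    have "D = Inv ` ball 0 (1 / (3 * r))"
    proof (intro set_eqI iffI)
      fix x assume "x \<in> D"
      show "x \<in> Inv ` ball 0 (1 / (3 * r))"
      proof (cases x)
        case (Fin z)
        then have z: "cmod z > 3 * r" using \<open>x \<in> D\<close> by (auto simp: D_def)
        then have "z \<noteq> 0" using r by auto
        with z have "x = Inv (1 / z)" "1 / z \<in> ball 0 (1 / (3 * r))"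
          using Fin r by (auto simp: norm_divide divide_strict_left_mono)
        then show ?thesis by blast
      next
        case Infty
        then have "x = Inv 0" by simp
        then show ?thesis using r by (intro image_eqI[of _ _ 0]) auto
      qed
    next
      fix x assume "x \<in> Inv ` ball 0 (1 / (3 * r))"
      then obtain w where w: "x = Inv w" "cmod w < 1 / (3 * r)"
        by (auto simp del: sphere_inverse.simps)
      show "x \<in> D"
      proof (cases "w = 0")
        case False
        then have "cmod (1 / w) > 3 * r" using w(2) r by (simp add: norm_divide field_simps)
        then show ?thesis using w(1) False by (simp add: D_def)
      qed (use w in \<open>simp add: D_def\<close>)
    qed
    then show ?thesis by (metis connected_ball connected_continuous_image continuous_on_Inv)
  qed
  \<comment> \<open>The boundary circle of \<open>D\<close> has to be included: the ray argument
    below reaches modulus exactly \<open>3 * r\<close>.\<close>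
  have big: "Fin z \<in> \<Omega>" if "cmod z \<ge> 3 * r" for z
    using est2[OF that] D\<Omega> f\<Omega> by blast
  have "connected \<Omega>" unfolding \<Omega>_def
  proof (rule connected_basin[OF continuous_f open_map_f \<open>open D\<close> conD fD])
    show "Infty \<in> D" by (simp add: D_def)
    fix x assume x: "f_map n c x = Infty"
    show "\<exists>C. connected C \<and> C \<subseteq> (\<Union>k. (f_map n c ^^ k) -` D) \<and> x \<in> C \<and> Infty \<in> C"
    proof (cases x)
      case Infty
      then show ?thesis using conD D\<Omega> \<open>Infty \<in> D\<close> unfolding \<Omega>_def by blast
    next
      case (Fin p)
      then have p: "p ^ n = c" using x by (auto split: if_splits)
      then have p0: "p \<noteq> 0" using c n by (auto simp: power_0_left)
      \<comment> \<open>In the coordinate \<open>1/z\<close> the ray from \<open>p\<close> to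
        infinity is the segment from \<open>1 / p\<close> to 0, so its connectedness, including the
        end at \<open>Infty\<close>, is immediate.\<close>
      define C where "C = (\<lambda>s. Inv (of_real s / p)) ` {0..1::real}"
      have "connected C" unfolding C_def
        by (intro connected_continuous_image continuous_on_compose2[OF continuous_on_Inv[of UNIV]]
              continuous_intros) (use p0 in auto)
      moreover have "x \<in> C" unfolding C_def using Fin p0 by (intro image_eqI[of _ _ 1]) auto
      moreover have "Infty \<in> C" unfolding C_def by (intro image_eqI[of _ _ 0]) auto
      moreover have "C \<subseteq> \<Omega>"
      proof -
        have "Inv (of_real s / p) \<in> \<Omega>" if s: "0 \<le> s" "s \<le> 1" for s
        proof -
          consider "s = 0" | "s = 1" | "0 < s" "s < 1" using s by linarith
          then show ?thesis
          proof cases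
            case 1
            then have "Inv (of_real s / p) = Infty" by simp
            then show ?thesis using D\<Omega> \<open>Infty \<in> D\<close> by (metis subsetD)
          next
            case 2
            then have "f_map n c (Inv (of_real s / p)) = Infty" using p p0 by simp
            then show ?thesis using f\<Omega> D\<Omega> \<open>Infty \<in> D\<close> by (metis subsetD)
          next
            case 3
            define u where "u = (1 / s) ^ n"
            have u: "u > 1" using 3 n by (simp add: u_def one_less_power)
            have zn: "(p / of_real s) ^ n = of_real u * c" by (simp add: u_def p power_divide)
            have "of_real u - 1 \<noteq> (0 :: complex)" using u
              by (metis less_irrefl of_real_1 right_minus_eq of_real_eq_iff)
            then have ne: "(p / of_real s) ^ n \<noteq> c" unfolding zn using c by simp
            have "F (p / of_real s) = of_real u * c + c\<^sup>2 / ((of_real u - 1) * c)"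
              unfolding F_def zn by (simp add: algebra_simps)
            also have "\<dots> = of_real (u + 1 / (u - 1)) * c"
              using c \<open>of_real u - 1 \<noteq> 0\<close> by (simp add: power2_eq_square field_simps)
            finally have "cmod (F (p / of_real s)) = (u + 1 / (u - 1)) * r"
              using u by (simp add: norm_mult r_def del: of_real_add of_real_divide of_real_diff)
            \<comment> \<open>The arithmetic-geometric mean inequality for \<open>u - 1\<close> and
              its reciprocal. Equality at \<open>u = 2\<close> is the critical value
              \<open>3 * c\<close>, which dictates the radius of \<open>D\<close>.\<close>
            moreover have "u + 1 / (u - 1) \<ge> 3"
            proof -
              have "(u - 1 - 1)\<^sup>2 / (u - 1) \<ge> 0" using u by simp
              also have "(u - 1 - 1)\<^sup>2 / (u - 1) = u + 1 / (u - 1) - 3"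
                using u by (simp add: field_simps power2_eq_square)
              finally show ?thesis by simp
            qed
            ultimately have "cmod (F (p / of_real s)) \<ge> 3 * r" using r by simp
            then have "Fin (F (p / of_real s)) \<in> \<Omega>" by (rule big)
            then have "Fin (p / of_real s) \<in> \<Omega>" using f\<Omega>[of "Fin (p / of_real s)"] f_Fin[OF ne] by metis
            moreover have "Inv (of_real s / p) = Fin (p / of_real s)" using 3 p0 by simp
            ultimately show ?thesis by metis
          qed
        qed
        then show ?thesis by (auto simp: C_def simp del: sphere_inverse.simps)
      qed
      ultimately show ?thesis unfolding \<Omega>_def by blast
    qed
  qed
  moreover have "D \<subseteq> fatou_set (f_map n c)"
    unfolding D_def
    by (rule escape_subset_fatou_set[where \<kappa> = "19/12"]) (use est r f_Fin in auto)
  then have "\<Omega> \<subseteq> fatou_set (f_map n c)" unfolding \<Omega>_def by (rule basin_subset_fatou_set)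
  moreover have "- closure \<Omega> \<subseteq> fatou_set (f_map n c)"
  proof -
    define S where "S = Fin -` (- closure \<Omega>)"
    have nD: "z \<in> {z. z ^ n \<noteq> c} \<inter> ball 0 (4 * r)" if z: "Fin z \<notin> \<Omega>" for z
    proof
      show "z \<in> {z. z ^ n \<noteq> c}"
      proof
        show "z ^ n \<noteq> c"
        proof
          assume "z ^ n = c"
          then have "f_map n c (Fin z) = Infty" by simp
          then show False using f\<Omega> D\<Omega> z by (auto simp: D_def)
        qed
      qed
      show "z \<in> ball 0 (4 * r)" using big[of z] z r by force
    qed
    have "Fin ` S \<subseteq> fatou_set (f_map n c)"
    proof (rule montel_chart[where G = F and T = "{z. z ^ n \<noteq> c} \<inter> ball 0 (4 * r)"])
      show "F holomorphic_on {z. z ^ n \<noteq> c} \<inter> ball 0 (4 * r)"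
        by (rule holomorphic_on_subset[OF holomorphic_F]) auto
      show "open ({z. z ^ n \<noteq> c} \<inter> ball 0 (4 * r))" using open_power_neq by blast
      show "open S" unfolding S_def by (rule open_vimage[OF _ continuous_on_Fin]) auto
      show "(F ^^ k) w \<in> {z. z ^ n \<noteq> c} \<inter> ball 0 (4 * r)" if "w \<in> S" for w k
      proof -
        have "Fin ((F ^^ k) w) \<notin> \<Omega>"
        proof (induction k)
          case 0
          then show ?case using that closure_subset[of \<Omega>] by (auto simp: S_def)
        next
          case (Suc k)
          then have "Fin ((F ^^ Suc k) w) = f_map n c (Fin ((F ^^ k) w))"
            using nD f_Fin by (simp del: f_map.simps)
          then show ?case using Suc f\<Omega> by metis
        qed
        then show ?thesis by (rule nD)
      qed
    qed (use f_Fin open_image_Fin dist_Fin_le in \<open>auto simp: inj_def simp del: f_map.simps\<close>)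
    moreover have "- closure \<Omega> \<subseteq> Fin ` S"
    proof
      fix x assume x: "x \<in> - closure \<Omega>"
      then have "x \<noteq> Infty" using D\<Omega> closure_subset[of \<Omega>] by (auto simp: D_def)
      then obtain z where "x = Fin z" by (cases x) auto
      then show "x \<in> Fin ` S" using x by (auto simp: S_def)
    qed
    ultimately show ?thesis by blast
  qed
  moreover have "Fin z \<in> \<Omega>" if "cmod z = 4 * cmod c" for z
    using big[of z] r that by (auto simp: r_def)
  moreover have "open \<Omega>" unfolding \<Omega>_def using \<open>open D\<close> by (rule open_basin)
  ultimately show ?thesis by blast
qed

end


section \<open>Transfer to the plane\<close>

text \<open>Puncturing a domain of the sphere at infinity does not disconnect it. If the plane part
  split, the connected set of points of large modulus would lie in one piece; adjoining
  \<open>Infty\<close> to that piece would split \<Omega> itself.\<close>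

lemma connected_vimage_Fin:
  assumes "open \<Omega>" "connected \<Omega>"
  shows "connected (Fin -` \<Omega>)"
proof -
  let ?W = "Fin -` \<Omega>"
  have opW: "open ?W" by (rule open_vimage[OF assms(1) continuous_on_Fin])
  obtain R where R: "Infty \<in> \<Omega> \<Longrightarrow> {z. cmod z > R} \<subseteq> ?W"
  proof (cases "Infty \<in> \<Omega>")
    case True
    have "open (Inv -` \<Omega>)" by (rule open_vimage[OF assms(1) continuous_on_Inv])
    then obtain e where e: "e > 0" "ball 0 e \<subseteq> Inv -` \<Omega>"
      using True by (metis openE sphere_inverse.simps(1) vimageI)
    have "z \<in> ?W" if z: "cmod z > 1 / e" for z
    proof -
      have z0: "z \<noteq> 0" using z e(1) by auto
      then have "cmod (1 / z) < e" using z e(1) by (simp add: norm_divide field_simps)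
      then have "1 / z \<in> Inv -` \<Omega>" using e(2) by (auto simp del: sphere_inverse.simps)
      then show ?thesis using z0 by simp
    qed
    then show ?thesis using that by blast
  qed (use that in auto)
  have no_split: False
    if AB: "open A" "open B" "A \<union> B = ?W" "A \<inter> B = {}" "A \<noteq> {}" "B \<noteq> {}"
      and A: "Infty \<in> \<Omega> \<Longrightarrow> {z. cmod z > R} \<subseteq> A" for A B
  proof -
    define A' where "A' = (if Infty \<in> \<Omega> then insert Infty (Fin ` A) else Fin ` A)"
    have "open A'"
      using A open_insert_Infty[OF AB(1), of R] open_image_Fin[OF AB(1)] by (auto simp: A'_def)
    moreover have "open (Fin ` B)" using AB(2) by (rule open_image_Fin)
    moreover have "A' \<union> Fin ` B = \<Omega>"
    proof (rule set_eqI)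
      fix x show "x \<in> A' \<union> Fin ` B \<longleftrightarrow> x \<in> \<Omega>"
        using AB(3) by (cases x) (auto simp: A'_def)
    qed
    moreover have "A' \<inter> Fin ` B = {}" using AB(4) by (auto simp: A'_def)
    moreover have "A' \<noteq> {}" "Fin ` B \<noteq> {}" using AB(5,6) by (auto simp: A'_def)
    ultimately show False using assms(2) unfolding connected_def by blast
  qed
  show ?thesis
    unfolding connected_def
  proof (intro notI, elim exE conjE)
    fix A\<^sub>0 B\<^sub>0 :: "complex set"
    assume AB\<^sub>0: "open A\<^sub>0" "open B\<^sub>0" "?W \<subseteq> A\<^sub>0 \<union> B\<^sub>0" "A\<^sub>0 \<inter> B\<^sub>0 \<inter> ?W = {}" "A\<^sub>0 \<inter> ?W \<noteq> {}" "B\<^sub>0 \<inter> ?W \<noteq> {}"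
    define A B where "A = A\<^sub>0 \<inter> ?W" and "B = B\<^sub>0 \<inter> ?W"
    have AB: "open A" "open B" "A \<union> B = ?W" "A \<inter> B = {}" "A \<noteq> {}" "B \<noteq> {}"
      using AB\<^sub>0 opW by (auto simp: A_def B_def)
    have "connected {z :: complex. cmod z > R}"
    proof -
      have "connected (- cball (0::complex) R)"
        by (rule connected_complement_bounded_convex) auto
      moreover have "- cball (0::complex) R = {z. cmod z > R}" by auto
      ultimately show ?thesis by simp
    qed
    then have "Infty \<in> \<Omega> \<Longrightarrow> {z. cmod z > R} \<subseteq> A \<or> {z. cmod z > R} \<subseteq> B"
      using connectedD[of "{z. cmod z > R}" A B] R AB by blast
    then show False
      using no_split[of A B] no_split[of B A] AB by (metis Int_commute Un_commute)
  qed
qed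

lemma Fin_in_closure:
  assumes "Fin z \<in> closure \<Omega>" shows "z \<in> closure (Fin -` \<Omega>)"
proof (rule ccontr)
  assume z: "z \<notin> closure (Fin -` \<Omega>)"
  have "open (Fin ` (- closure (Fin -` \<Omega>)))" by (rule open_image_Fin) auto
  moreover have "Fin z \<in> Fin ` (- closure (Fin -` \<Omega>))" using z by blast
  ultimately have "Fin ` (- closure (Fin -` \<Omega>)) \<inter> \<Omega> \<noteq> {}"
    using assms by (metis Int_iff empty_iff open_Int_closure_eq_empty)
  then show False using closure_subset[of "Fin -` \<Omega>"] by auto
qed

lemma (in f_family) ex_plane_basin:
  obtains \<Omega> s where "open \<Omega>" "connected \<Omega>" "Fin ` \<Omega> \<subseteq> fatou_set (f_map n c)"
    "julia_set (f_map n c) \<subseteq> Fin ` (closure \<Omega> - \<Omega>)"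
    "s > 0" "sphere 0 s \<subseteq> \<Omega>"
proof -
  have "\<exists>\<Omega> s. open \<Omega> \<and> connected \<Omega> \<and> \<Omega> \<subseteq> fatou_set (f_map n c) \<and>
     - closure \<Omega> \<subseteq> fatou_set (f_map n c) \<and> s > 0 \<and> (\<forall>z. cmod z = s \<longrightarrow> Fin z \<in> \<Omega>)"
  proof (cases "cmod c ^ (n - 1) * 3 ^ n \<le> 5")
    case True
    from ex_basin_small[OF this] show ?thesis using c by (metis zero_less_norm_iff)
  next
    case False
    then have "cmod c ^ (n - 1) * 3 ^ n \<ge> 5" by simp
    from ex_basin_large[OF this] show ?thesis using c
      by (metis mult_pos_pos zero_less_norm_iff zero_less_numeral)
  qed
  then obtain \<Omega> s where \<Omega>: "open \<Omega>" "connected \<Omega>" "\<Omega> \<subseteq> fatou_set (f_map n c)"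
     "- closure \<Omega> \<subseteq> fatou_set (f_map n c)" "s > 0" "\<And>z. cmod z = s \<Longrightarrow> Fin z \<in> \<Omega>" by blast
  have "x \<in> Fin ` (closure (Fin -` \<Omega>) - Fin -` \<Omega>)" if x: "x \<in> julia_set (f_map n c)" for x
  proof -
    have "x \<noteq> Infty" "x \<in> closure \<Omega>" "x \<notin> \<Omega>"
      using x Infty_in_fatou_set \<Omega>(3,4) by (auto simp: julia_set_def)
    moreover obtain z where "x = Fin z" using \<open>x \<noteq> Infty\<close> by (cases x) auto
    ultimately show ?thesis using Fin_in_closure by blast
  qed
  then show ?thesis
    using that[of "Fin -` \<Omega>" s] open_vimage[OF \<Omega>(1) continuous_on_Fin]
      connected_vimage_Fin[OF \<Omega>(1,2)] \<Omega> by (auto simp: subset_iff)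
qed

section \<open>Jordan curves in the frontier of a domain\<close>

lemma connected_subset_if_disjoint_frontier:
  assumes "connected X" "X \<inter> Y \<noteq> {}" "X \<inter> frontier Y = {}"
  shows "X \<subseteq> Y"
  using connected_Int_frontier[OF assms(1,2)] assms(3) by blast

text \<open>The sides are named by their position relative to \<Omega>, not as inside and outside:
  \<open>T\<close>, the side free of \<Omega>, may well be the unbounded one.\<close>

lemma Jordan_sides:
  fixes \<Omega> :: "complex set"
  assumes "closed_jordan_curve \<Gamma>" "connected \<Omega>" "\<Omega> \<inter> \<Gamma> = {}"
  obtains S T where "open S" "connected S" "open T" "connected T" "S \<union> T = - \<Gamma>" "S \<inter> T = {}"
    "frontier T = \<Gamma>" "T \<noteq> {}" "\<Omega> \<subseteq> S"
proof -
  from assms(1) obtain \<gamma> where \<gamma>: "simple_path \<gamma>" "pathfinish \<gamma> = pathstart \<gamma>" "path_image \<gamma> = \<Gamma>"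
    by (auto simp: closed_jordan_curve_def)
  obtain A B where AB: "A \<noteq> {}" "open A" "connected A" "B \<noteq> {}" "open B" "connected B"
      "A \<inter> B = {}" "A \<union> B = - \<Gamma>" "frontier A = \<Gamma>" "frontier B = \<Gamma>"
    using Jordan_curve[OF \<gamma>(1,2)] unfolding \<gamma>(3) by metis
  have "\<Omega> \<subseteq> A \<or> \<Omega> \<subseteq> B"
    using connectedD[OF assms(2) AB(2,5)] assms(3) AB(7,8) by blast
  then show ?thesis
  proof
    assume "\<Omega> \<subseteq> A"
    then show ?thesis using that[of A B] AB by blast
  next
    assume "\<Omega> \<subseteq> B"
    then show ?thesis using that[of B A] AB by (simp add: Int_commute Un_commute)
  qed
qed

text \<open>An open set missing \<Omega> misses its closure, and both curves lie in that closure. If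
  \<open>T\<close> and \<open>T'\<close> meet, neither can cross the frontier of the other, so they
  coincide, and so do their frontiers. The curves may intersect, which is essential for the three
  cycles of a theta curve.\<close>

lemma other_sides_disjoint:
  assumes "open \<Omega>" "\<Gamma> \<subseteq> closure \<Omega>" "\<Gamma>' \<subseteq> closure \<Omega>" "\<Gamma> \<noteq> \<Gamma>'"
    and T: "open T" "connected T" "frontier T = \<Gamma>" "T \<inter> \<Omega> = {}"
    and T': "open T'" "connected T'" "frontier T' = \<Gamma>'" "T' \<inter> \<Omega> = {}"
  shows "T \<inter> T' = {}"
proof (rule ccontr)
  assume meet: "T \<inter> T' \<noteq> {}"
  have "T \<inter> closure \<Omega> = {}" "T' \<inter> closure \<Omega> = {}"
    using T T' by (simp_all add: open_Int_closure_eq_empty)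
  then have dj: "T \<inter> frontier T' = {}" "T' \<inter> frontier T = {}" using assms(2,3) T(3) T'(3) by blast+
  have "T \<subseteq> T'" using connected_subset_if_disjoint_frontier[OF T(2) meet dj(1)] .
  moreover have "T' \<inter> T \<noteq> {}" using meet by blast
  then have "T' \<subseteq> T" using connected_subset_if_disjoint_frontier[OF T'(2) _ dj(2)] by blast
  ultimately have "T = T'" by blast
  then show False using T(3) T'(3) assms(4) by blast
qed

lemma countable_disjoint_Jordan_curves_in_frontier:
  fixes \<Omega> :: "complex set"
  assumes "open \<Omega>" "connected \<Omega>"
    and \<J>: "\<And>J. J \<in> \<J> \<Longrightarrow> closed_jordan_curve J" "\<And>J. J \<in> \<J> \<Longrightarrow> J \<subseteq> closure \<Omega> - \<Omega>"
  shows "countable \<J>"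
proof -
  have "\<exists>T. open T \<and> connected T \<and> frontier T = J \<and> T \<noteq> {} \<and> T \<inter> \<Omega> = {}" if J: "J \<in> \<J>" for J
  proof -
    have "\<Omega> \<inter> J = {}" using \<J>(2)[OF J] by blast
    then obtain S T where "open T" "connected T" "S \<inter> T = {}" "frontier T = J" "T \<noteq> {}" "\<Omega> \<subseteq> S"
      by (rule Jordan_sides[OF \<J>(1)[OF J] assms(2)])
    then show ?thesis by (intro exI[of _ T]) auto
  qed
  then obtain T where T: "\<And>J. J \<in> \<J> \<Longrightarrow> open (T J) \<and> connected (T J) \<and> frontier (T J) = J
      \<and> T J \<noteq> {} \<and> T J \<inter> \<Omega> = {}" by metis
  have "countable (T ` \<J>)"
  proof (rule countable_disjoint_open_subsets)
    show "pairwise disjnt (T ` \<J>)"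
      unfolding pairwise_image
    proof (rule pairwiseI, intro impI)
      fix J J' assume J: "J \<in> \<J>" "J' \<in> \<J>" "J \<noteq> J'"
      show "disjnt (T J) (T J')"
        unfolding disjnt_def
        by (rule other_sides_disjoint[OF assms(1), where \<Gamma> = J and \<Gamma>' = J'];
            use J T[of J] T[of J'] \<J>(2) in blast)
    qed
  qed (use T in auto)
  moreover have "inj_on T \<J>" using T by (metis inj_onI)
  ultimately show ?thesis by (rule countable_image_inj_on)
qed

text \<open>Each of the three cycles has a side free of \<Omega>. A point \<open>p\<close> of
  \<open>T 1 2\<close> avoids the other two free sides, so it lies on the same side as \<Omega> for
  both \<open>C 1 3\<close> and \<open>C 2 3\<close>. These two cycles meet in a single arc, a
  connected set, as Janiszewski's theorem demands.\<close>

lemma no_theta_curve_in_frontier: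
  fixes \<Omega> :: "complex set"
  assumes \<Omega>: "open \<Omega>" "connected \<Omega>"
    and arcs: "\<And>i. i \<in> {1,2,3::nat} \<Longrightarrow> arc (\<gamma> i) \<and> pathstart (\<gamma> i) = a \<and> pathfinish (\<gamma> i) = b"
    and meet: "\<And>i j. i \<in> {1,2,3} \<Longrightarrow> j \<in> {1,2,3} \<Longrightarrow> i \<noteq> j \<Longrightarrow> path_image (\<gamma> i) \<inter> path_image (\<gamma> j) = {a, b}"
    and sub: "\<And>i. i \<in> {1,2,3} \<Longrightarrow> path_image (\<gamma> i) \<subseteq> closure \<Omega> - \<Omega>"
  shows False
proof -
  define C where "C i j = path_image (\<gamma> i) \<union> path_image (\<gamma> j)" for i j
  have Jordan: "closed_jordan_curve (C i j)" if ij: "i \<in> {1,2,3}" "j \<in> {1,2,3}" "i \<noteq> j" for i j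
    unfolding closed_jordan_curve_def
  proof (intro exI[of _ "\<gamma> i +++ reversepath (\<gamma> j)"] conjI)
    show "simple_path (\<gamma> i +++ reversepath (\<gamma> j))"
      using arcs[OF ij(1)] arcs[OF ij(2)] meet[OF ij]
      by (intro simple_path_join_loop) (auto simp: arc_reversepath)
  qed (use arcs[OF ij(1)] arcs[OF ij(2)] in \<open>auto simp: C_def path_image_join\<close>)
  have "\<exists>S T. open S \<and> connected S \<and> open T \<and> connected T \<and> S \<union> T = - C i j \<and> S \<inter> T = {} \<and>
      frontier T = C i j \<and> T \<noteq> {} \<and> \<Omega> \<subseteq> S" if ij: "i \<in> {1,2,3}" "j \<in> {1,2,3}" "i \<noteq> j" for i j
  proof -
    have "\<Omega> \<inter> C i j = {}" using sub[OF ij(1)] sub[OF ij(2)] by (auto simp: C_def)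
    then show ?thesis by (rule Jordan_sides[OF Jordan[OF ij] \<Omega>(2)]) blast
  qed
  then obtain S T where ST: "\<And>i j. i \<in> {1,2,3} \<Longrightarrow> j \<in> {1,2,3} \<Longrightarrow> i \<noteq> j \<Longrightarrow>
      open (S i j) \<and> connected (S i j) \<and> open (T i j) \<and> connected (T i j) \<and> S i j \<union> T i j = - C i j
      \<and> S i j \<inter> T i j = {} \<and> frontier (T i j) = C i j \<and> T i j \<noteq> {} \<and> \<Omega> \<subseteq> S i j" by metis
  have 12: "T 1 2 \<inter> T 1 3 = {}" "T 1 2 \<inter> T 2 3 = {}"
  proof -
    have ne: "path_image (\<gamma> i) \<noteq> {a, b}" if "i \<in> {1,2,3}" for i
    proof
      assume "path_image (\<gamma> i) = {a, b}"
      moreover have "connected (path_image (\<gamma> i))" "a \<noteq> b"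
        using arcs[OF that] arc_distinct_ends[of "\<gamma> i"] connected_arc_image[of "\<gamma> i"] by auto
      ultimately show False
        using connected_finite_iff_sing[of "path_image (\<gamma> i)"] by (auto simp: doubleton_eq_iff)
    qed
    have "C 1 2 \<noteq> C 1 3" "C 1 2 \<noteq> C 2 3"
    proof -
      have "a \<in> path_image (\<gamma> 3)" "b \<in> path_image (\<gamma> 3)"
        using arcs[of 3] pathstart_in_path_image[of "\<gamma> 3"] pathfinish_in_path_image[of "\<gamma> 3"] by auto
      then obtain x where x: "x \<in> path_image (\<gamma> 3)" "x \<notin> {a, b}" using ne[of 3] by blast
      then have "x \<notin> path_image (\<gamma> 1)" "x \<notin> path_image (\<gamma> 2)"
        using meet[of 1 3] meet[of 2 3] by auto
      then have "x \<notin> C 1 2" "x \<in> C 1 3" "x \<in> C 2 3" using x(1) by (simp_all add: C_def)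
      then show "C 1 2 \<noteq> C 1 3" "C 1 2 \<noteq> C 2 3" by auto
    qed
    note neC = this
    have subC: "C 1 2 \<subseteq> closure \<Omega>" "C 1 3 \<subseteq> closure \<Omega>" "C 2 3 \<subseteq> closure \<Omega>"
      using sub[of 1] sub[of 2] sub[of 3] by (auto simp: C_def)
    show "T 1 2 \<inter> T 1 3 = {}"
      by (rule other_sides_disjoint[OF \<Omega>(1) subC(1,2) neC(1)]) (use ST[of 1 2] ST[of 1 3] in auto)
    show "T 1 2 \<inter> T 2 3 = {}"
      by (rule other_sides_disjoint[OF \<Omega>(1) subC(1,3) neC(2)]) (use ST[of 1 2] ST[of 2 3] in auto)
  qed
  obtain p where p: "p \<in> T 1 2" using ST[of 1 2] by auto
  have "closure \<Omega> \<noteq> {}" using sub[of 1] path_image_nonempty[of "\<gamma> 1"] by auto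
  then obtain w where w: "w \<in> \<Omega>" by auto
  have "T 1 2 \<inter> \<Omega> = {}" using ST[of 1 2] by auto
  then have "T 1 2 \<inter> closure \<Omega> = {}" using ST[of 1 2] by (simp add: open_Int_closure_eq_empty)
  then have pC: "p \<notin> C i j" if "i \<in> {1,2,3}" "j \<in> {1,2,3}" for i j
    using p sub[OF that(1)] sub[OF that(2)] by (auto simp: C_def)
  have "p \<in> S 1 3" "p \<in> S 2 3" using 12 p pC[of 1 3] pC[of 2 3] ST[of 1 3] ST[of 2 3] by auto
  have cc: "connected_component (- C i j) p w" if "i \<in> {1,2,3}" "j \<in> {1,2,3}" "i \<noteq> j" "p \<in> S i j" for i j
    unfolding connected_component_def
    using ST[OF that(1-3)] w that(4) by (intro exI[of _ "S i j"]) auto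
  have compact: "compact (C i j)" if "i \<in> {1,2,3}" "j \<in> {1,2,3}" for i j
    using arcs[OF that(1)] arcs[OF that(2)]
    by (auto simp: C_def intro!: compact_Un compact_path_image arc_imp_path)
  \<comment> \<open>Neither \<open>C 1 3\<close> nor \<open>C 2 3\<close> separates \<open>p\<close> from \<open>w\<close>, but their union contains \<open>C 1 2\<close>, which does.\<close>
  have "connected_component (- (C 1 3 \<union> C 2 3)) p w"
  proof (rule Janiszewski)
    have "C 1 3 \<inter> C 2 3 = path_image (\<gamma> 3)"
    proof -
      have "{a, b} \<subseteq> path_image (\<gamma> 3)"
        using arcs[of 3] pathstart_in_path_image[of "\<gamma> 3"] pathfinish_in_path_image[of "\<gamma> 3"] by auto
      then show ?thesis using meet[of 1 2] unfolding C_def by fastforce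
    qed
    then show "connected (C 1 3 \<inter> C 2 3)" using arcs[of 3] by (simp add: connected_arc_image)
  qed (use cc \<open>p \<in> S 1 3\<close> \<open>p \<in> S 2 3\<close> compact compact_imp_closed[OF compact[of 2 3]] in auto)
  then obtain X where X: "connected X" "X \<subseteq> - (C 1 3 \<union> C 2 3)" "p \<in> X" "w \<in> X"
    by (auto simp: connected_component_def)
  have "X \<subseteq> T 1 2"
    using X p ST[of 1 2] by (intro connected_subset_if_disjoint_frontier) (auto simp: C_def)
  then show False using X(4) w \<open>T 1 2 \<inter> \<Omega> = {}\<close> by blast
qed


section \<open>Sets contained in the frontier of a plane domain\<close>

lemma inj_Fin: "inj Fin"
  by (auto intro: injI)

lemma continuous_on_inv_Fin: "X \<subseteq> range Fin \<Longrightarrow> continuous_on X (inv Fin)"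
  using continuous_on_inv_open_map[OF inj_Fin open_image_Fin] continuous_on_subset by blast

lemma inv_Fin_Fin [simp]: "inv Fin (Fin z) = z"
  using inj_Fin by simp

lemma closed_jordan_curve_homeo_image:
  assumes "closed_jordan_curve J" "continuous_on J h" "inj_on h J"
  shows "closed_jordan_curve (h ` J)"
proof -
  obtain \<gamma> where "simple_path \<gamma>" "pathfinish \<gamma> = pathstart \<gamma>" "path_image \<gamma> = J"
    using assms(1) by (auto simp: closed_jordan_curve_def)
  then have "simple_path (h \<circ> \<gamma>)" "pathfinish (h \<circ> \<gamma>) = pathstart (h \<circ> \<gamma>)" "path_image (h \<circ> \<gamma>) = h ` J"
    using assms(2,3) by (auto intro!: simple_path_continuous_image
      simp: pathfinish_compose pathstart_compose path_image_compose)
  then show ?thesis unfolding closed_jordan_curve_def by blast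
qed

lemma not_cantor_set_of_circles_if_subset_frontier:
  assumes \<Omega>: "open \<Omega>" "connected \<Omega>" and S: "S \<subseteq> Fin ` (closure \<Omega> - \<Omega>)"
  shows "\<not> cantor_set_of_circles S"
proof
  assume "cantor_set_of_circles S"
  then obtain \<J> where \<J>: "uncountable \<J>" "\<And>J. J \<in> \<J> \<Longrightarrow> closed_jordan_curve J" "\<Union>\<J> = S"
    unfolding cantor_set_of_circles_def by blast
  have "countable ((\<lambda>J. inv Fin ` J) ` \<J>)"
  proof (rule countable_disjoint_Jordan_curves_in_frontier[OF \<Omega>])
    fix J' assume "J' \<in> (\<lambda>J. inv Fin ` J) ` \<J>"
    then obtain J where J: "J \<in> \<J>" "J' = inv Fin ` J" by blast
    have J_sub: "J \<subseteq> Fin ` (closure \<Omega> - \<Omega>)" using J(1) \<J>(3) S by blast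
    then show "J' \<subseteq> closure \<Omega> - \<Omega>" unfolding J(2) by auto
    have "J \<subseteq> range Fin" using J_sub by blast
    then show "closed_jordan_curve J'"
      unfolding J(2) using continuous_on_inv_Fin \<J>(2)[OF J(1)]
      by (intro closed_jordan_curve_homeo_image) (auto simp: inj_on_def subset_iff inv_into_injective)
  qed
  moreover have "inj_on (\<lambda>J. inv Fin ` J) \<J>"
  proof (rule inj_onI)
    fix J K assume JK: "J \<in> \<J>" "K \<in> \<J>" "inv Fin ` J = inv Fin ` K"
    have "Fin ` inv Fin ` X = X" if "X \<in> \<J>" for X
    proof -
      have "X \<subseteq> range Fin" using that \<J>(3) S by blast
      then show ?thesis by (simp add: image_f_inv_f image_inv_into_cancel)
    qed
    then show "J = K" using JK by metis
  qed
  ultimately show False using \<J>(1) countable_image_inj_on by blast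
qed

section \<open>A theta curve inside the Sierpinski carpet\<close>

lemma carpet_level_cell:
  assumes "(i, j) \<in> {0, 1, 2} \<times> {0, 1, 2} - {(1, 1)}" "(x, y) \<in> carpet_level k"
  shows "((x + i) / 3, (y + j) / 3) \<in> carpet_level (Suc k)"
  unfolding carpet_level.simps
  by (rule UN_I[OF assms(1)], unfold prod.case, rule image_eqI[OF _ assms(2)]) simp

text \<open>Each third of a side of the square is the corresponding side of a border cell, and only
  the central cell is removed.\<close>

lemma carpet_level_sides: 
  "x \<in> {0..1} \<Longrightarrow> (x, 0) \<in> carpet_level k \<and> (x, 1) \<in> carpet_level k \<and>
     (0, x) \<in> carpet_level k \<and> (1, x) \<in> carpet_level k"
proof (induction k arbitrary: x)
  case (Suc k)
  have cell: "((x + i) / 3, (y + j) / 3) \<in> carpet_level (Suc k)"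
    if "(i, j) \<in> {0, 1, 2} \<times> {0, 1, 2} - {(1, 1)}" "(x, y) \<in> carpet_level k" for i j x y
    using carpet_level_cell that by blast
  obtain i t where it: "i \<in> {0,1,2}" "t \<in> {0..1}" "x = (t + i) / 3"
  proof -
    consider "x \<le> 1/3" | "1/3 \<le> x" "x \<le> 2/3" | "2/3 \<le> x" by linarith
    then show ?thesis
      using that[of 0 "3 * x"] that[of 1 "3 * x - 1"] that[of 2 "3 * x - 2"] Suc.prems by cases auto
  qed
  note IH = Suc.IH[OF it(2)]
  let ?I = "{0, 1, 2} \<times> {0, 1, 2} - {(1, 1)} :: (real \<times> real) set"
  have c: "(i, 0) \<in> ?I" "(i, 2) \<in> ?I"
    "(0, i) \<in> ?I" "(2, i) \<in> ?I"
    using it(1) by auto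
  show ?case
    using cell[OF c(1), of t 0] cell[OF c(2), of t 1] cell[OF c(3), of 0 t] cell[OF c(4), of 1 t] IH
    unfolding it(3) by (simp del: carpet_level.simps)
qed auto

text \<open>This line carries the right-hand sides of the cells in the left column, all of which are
  kept. It provides the chord of the theta curve.\<close>

lemma carpet_level_third: "y \<in> {0..1} \<Longrightarrow> (1/3, y) \<in> carpet_level k"
proof (cases k)
  case (Suc k')
  assume y: "y \<in> {0..1}"
  obtain j t where jt: "j \<in> {0,1,2}" "t \<in> {0..1}" "y = (t + j) / 3"
  proof -
    consider "y \<le> 1/3" | "1/3 \<le> y" "y \<le> 2/3" | "2/3 \<le> y" by linarith
    then show ?thesis
      using that[of 0 "3 * y"] that[of 1 "3 * y - 1"] that[of 2 "3 * y - 2"] y by cases auto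
  qed
  have "(1, t) \<in> carpet_level k'" using carpet_level_sides[OF jt(2)] by blast
  then have "(1/3, (t + j) / 3) \<in> carpet_level (Suc k')" using jt(1)
    using carpet_level_cell[of 0 j 1 t k'] by (auto simp del: carpet_level.simps)
  then show ?thesis unfolding jt(3) Suc .
qed auto

lemma sierpinski_carpet_sides:
  "x \<in> {0..1} \<Longrightarrow> (x, 0) \<in> sierpinski_carpet" "x \<in> {0..1} \<Longrightarrow> (x, 1) \<in> sierpinski_carpet"
  "x \<in> {0..1} \<Longrightarrow> (0, x) \<in> sierpinski_carpet" "x \<in> {0..1} \<Longrightarrow> (1, x) \<in> sierpinski_carpet"
  "x \<in> {0..1} \<Longrightarrow> (1/3, x) \<in> sierpinski_carpet"
  using carpet_level_sides carpet_level_third by (auto simp: sierpinski_carpet_def)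

lemma closed_segment_horizontal:
  "closed_segment (a, y) (b, y) = closed_segment a b \<times> {y :: real}" for a b :: real
proof -
  have "(1 - u) * y + u * y = y" for u :: real by (simp add: algebra_simps)
  then show ?thesis by (auto simp: closed_segment_def)
qed

lemma closed_segment_vertical:
  "closed_segment (x, a) (x, b) = {x :: real} \<times> closed_segment a b" for a b :: real
proof -
  have "(1 - u) * x + u * x = x" for u :: real by (simp add: algebra_simps)
  then show ?thesis by (auto simp: closed_segment_def)
qed

text \<open>The theta curve formed by the boundary of the unit square and the chord at abscissa
  \<open>1/3\<close>, with branch points \<open>(1/3, 0)\<close> and \<open>(1/3, 1)\<close>: left
  part of the boundary, right part, chord.\<close>

definition carpet_arc :: "nat \<Rightarrow> real \<Rightarrow> real \<times> real" where
  "carpet_arc i = (if i = 1 then linepath (1/3, 0) (0, 0) +++ linepath (0, 0) (0, 1) +++ linepath (0, 1) (1/3, 1)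
     else if i = 2 then linepath (1/3, 0) (1, 0) +++ linepath (1, 0) (1, 1) +++ linepath (1, 1) (1/3, 1)
     else linepath (1/3, 0) (1/3, 1))"

lemma path_image_carpet_arc:
  "path_image (carpet_arc 1) = {0..1/3} \<times> {0} \<union> {0} \<times> {0..1} \<union> {0..1/3} \<times> {1}"
  "path_image (carpet_arc 2) = {1/3..1} \<times> {0} \<union> {1} \<times> {0..1} \<union> {1/3..1} \<times> {1}"
  "path_image (carpet_arc 3) = {1/3} \<times> {0..1}"
  by (auto simp: carpet_arc_def path_image_join closed_segment_horizontal closed_segment_vertical
      closed_segment_eq_real_ivl)

lemma carpet_arc:
  assumes "i \<in> {1,2,3}"
  shows "arc (carpet_arc i)" "pathstart (carpet_arc i) = (1/3, 0)" "pathfinish (carpet_arc i) = (1/3, 1)"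
proof -
  have "arc (linepath (a, 0 :: real) (b, 0) +++ linepath (b, 0) (b, 1) +++ linepath (b, 1) (a, 1))"
    if "a \<noteq> b" for a b :: real
    using that
    by (intro arc_join arc_linepath)
      (auto simp: path_image_join closed_segment_horizontal closed_segment_vertical closed_segment_eq_real_ivl)
  then show "arc (carpet_arc i)" using assms by (auto simp: carpet_arc_def)
qed (use assms in \<open>auto simp: carpet_arc_def\<close>)

lemma carpet_arc_subset:
  assumes "i \<in> {1,2,3}" shows "path_image (carpet_arc i) \<subseteq> sierpinski_carpet"
proof -
  consider "i = 1" | "i = 2" | "i = 3" using assms by blast
  then show ?thesis
    by cases (simp_all only: path_image_carpet_arc, auto intro!: sierpinski_carpet_sides)
qed

lemma not_sierpinski_curve_if_subset_frontier:
  assumes \<Omega>: "open \<Omega>" "connected \<Omega>" and S: "S \<subseteq> Fin ` (closure \<Omega> - \<Omega>)"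
  shows "\<not> sierpinski_curve S"
proof
  assume "sierpinski_curve S"
  then have "sierpinski_carpet homeomorphic S"
    unfolding sierpinski_curve_def using homeomorphic_sym by blast
  then obtain h k where hk: "homeomorphism sierpinski_carpet S h k"
    by (auto simp: homeomorphic_def)
  define g where "g = inv Fin \<circ> h"
  have h: "continuous_on sierpinski_carpet h" "h ` sierpinski_carpet = S" "inj_on h sierpinski_carpet"
    using hk by (auto simp: homeomorphism_def intro: inj_on_inverseI)
  have S_sub: "S \<subseteq> range Fin" using S by blast
  have cont: "continuous_on sierpinski_carpet g"
    unfolding g_def by (rule continuous_on_compose[OF h(1)]) (simp add: h(2) continuous_on_inv_Fin S_sub)
  have inj: "inj_on g sierpinski_carpet"
    unfolding g_def using h(2,3) S_sub by (intro comp_inj_on) (auto intro: inj_on_inv_into)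
  have im: "g ` sierpinski_carpet \<subseteq> closure \<Omega> - \<Omega>"
    unfolding g_def image_comp[symmetric] h(2) using S by auto
  show False
  proof (rule no_theta_curve_in_frontier[OF \<Omega>, where \<gamma> = "\<lambda>i. g \<circ> carpet_arc i"])
    fix i :: nat assume i: "i \<in> {1,2,3}"
    show "arc (g \<circ> carpet_arc i) \<and> pathstart (g \<circ> carpet_arc i) = g (1/3, 0) \<and>
       pathfinish (g \<circ> carpet_arc i) = g (1/3, 1)"
    proof -
      have "path (g \<circ> carpet_arc i)"
        using carpet_arc(1)[OF i] continuous_on_subset[OF cont carpet_arc_subset[OF i]]
        by (intro path_continuous_image arc_imp_path)
      moreover have "inj_on (g \<circ> carpet_arc i) {0..1}"
        using carpet_arc(1)[OF i] inj_on_subset[OF inj carpet_arc_subset[OF i]]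
        by (intro comp_inj_on) (auto simp: arc_def path_image_def)
      ultimately show ?thesis
        using carpet_arc(2,3)[OF i] by (simp add: arc_def pathstart_compose pathfinish_compose)
    qed
    show "path_image (g \<circ> carpet_arc i) \<subseteq> closure \<Omega> - \<Omega>"
      using carpet_arc_subset[OF i] im by (auto simp: path_image_compose)
  next
    fix i j :: nat assume ij: "i \<in> {1,2,3}" "j \<in> {1,2,3}" "i \<noteq> j"
    have "path_image (carpet_arc i) \<inter> path_image (carpet_arc j) = {(1/3, 0), (1/3, 1)}"
      using ij path_image_carpet_arc by (elim insertE emptyE) (simp_all, auto)
    then show "path_image (g \<circ> carpet_arc i) \<inter> path_image (g \<circ> carpet_arc j) = {g (1/3, 0), g (1/3, 1)}"
      using inj_on_image_Int[OF inj carpet_arc_subset[OF ij(1)] carpet_arc_subset[OF ij(2)]]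
      by (simp add: path_image_compose)
  qed
qed


section \<open>Herman rings\<close>

lemma ex_norm_greater_in_open:
  assumes "open B" "z \<in> B"
  shows "\<exists>w\<in>B. cmod w > cmod z"
proof (rule ccontr)
  assume "\<not> ?thesis"
  then have le: "\<And>w. w \<in> B \<Longrightarrow> cmod w \<le> cmod z" by force
  obtain e where e: "e > 0" "ball z e \<subseteq> B" using assms by (meson openE)
  \<comment> \<open>A unit vector pointing outwards at \<open>z\<close>; at the origin, where
    \<open>sgn\<close> vanishes, any direction will do.\<close>
  define u where "u = (if z = 0 then 1 else sgn z)"
  have "cmod u = 1" by (simp add: u_def norm_sgn)
  moreover have "z = of_real (cmod z) * u" by (simp add: u_def sgn_div_norm scaleR_conv_of_real)
  ultimately have u: "cmod u = 1" "z = of_real (cmod z) * u" by blast+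
  have "cmod (z + of_real (e / 2) * u) = cmod z + e / 2"
  proof -
    have "z + of_real (e / 2) * u = of_real (cmod z + e / 2) * u"
      by (subst u(2)) (simp add: algebra_simps)
    then show ?thesis using u(1) e(1) by (simp add: norm_mult del: of_real_add)
  qed
  moreover have "z + of_real (e / 2) * u \<in> ball z e"
    using e(1) u(1) by (simp add: dist_norm norm_mult)
  then have "cmod (z + of_real (e / 2) * u) \<le> cmod z" using le e(2) by blast
  ultimately show False using e(1) by simp
qed

lemma ex_norm_less_in_open:
  assumes "open B" "z \<in> B" "z \<noteq> 0"
  shows "\<exists>w\<in>B. cmod w < cmod z"
proof -
  obtain e where e: "e > 0" "ball z e \<subseteq> B" using assms by (meson openE)
  define d where "d = min (e / 2) (cmod z)"
  have d: "d > 0" "d < e" "d \<le> cmod z" using e(1) assms(3) by (auto simp: d_def)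
  have "z - of_real d * sgn z = of_real (cmod z - d) * sgn z"
    using assms(3) by (simp add: sgn_div_norm scaleR_conv_of_real field_simps)
  then have "cmod (z - of_real d * sgn z) = cmod z - d"
    using d assms(3) by (simp add: norm_mult norm_sgn del: of_real_diff)
  moreover have "z - of_real d * sgn z \<in> ball z e"
    using d assms(3) by (simp add: dist_norm norm_mult norm_sgn)
  ultimately show ?thesis using e(2) d(1) by (metis diff_less_eq less_add_same_cancel1 subsetD)
qed

lemma sphere_holomorphic_on_imp_continuous_on:
  assumes "sphere_holomorphic_on \<phi> A"
  shows "continuous_on A \<phi>"
proof (rule continuous_at_imp_continuous_on, rule ballI)
  fix z assume "z \<in> A"
  then obtain V g where V: "open V" "z \<in> V" "g holomorphic_on V"
    "(\<forall>w\<in>V. \<phi> w = Fin (g w)) \<or> (\<forall>w\<in>V. \<phi> w = Inv (g w))"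
    using assms unfolding sphere_holomorphic_on_def by metis
  have g: "continuous_on V g" using V(3) by (rule holomorphic_on_imp_continuous_on)
  have "continuous_on V \<phi>"
    using V(4)
  proof
    assume eq: "\<forall>w\<in>V. \<phi> w = Fin (g w)"
    have "continuous_on V (\<lambda>w. Fin (g w))"
      by (rule continuous_on_compose2[OF continuous_on_Fin g]) auto
    then show ?thesis using eq continuous_on_cong by (metis (no_types, lifting))
  next
    assume eq: "\<forall>w\<in>V. \<phi> w = Inv (g w)"
    have "continuous_on V (\<lambda>w. Inv (g w))"
      by (rule continuous_on_compose2[OF continuous_on_Inv g]) auto
    then show ?thesis using eq continuous_on_cong by (metis (no_types, lifting))
  qed
  then show "isCont \<phi> z" using V(1,2) continuous_on_eq_continuous_at by blast
qed

lemma subset_component_if_connected: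
  assumes "U \<in> components X" "connected Y" "Y \<subseteq> X" "Y \<inter> U \<noteq> {}"
  shows "Y \<subseteq> U"
  using assms by (metis Int_commute components_maximal)

lemma Infty_in_closure_unbounded:
  assumes "\<not> bounded X" shows "Infty \<in> closure (Fin ` X)"
  unfolding closure_approachable
proof (intro allI impI)
  fix e :: real assume e: "e > 0"
  obtain z where z: "z \<in> X" "cmod z > 2 / e" using assms by (meson bounded_iff not_le)
  have z0: "cmod z > 0" using z(2) e by (smt (verit) divide_pos_pos)
  then have "dist (Fin z) Infty \<le> 2 / cmod z" by (intro dist_Fin_Infty_le) auto
  also have "\<dots> < e" using z(2) z0 e by (simp add: field_simps)
  finally show "\<exists>y\<in>Fin ` X. dist y Infty < e" using z(1) by blast
qed

text \<open>\<open>X\<close> plays the Fatou set. Both sides of the core curve of an annulus must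
  contain points outside the annulus, but the side missing \<Omega> contains no point of
  \<open>- X\<close>. Continuity and injectivity of \<phi> are enough, since invariance of domain
  supplies open images.\<close>

lemma annular_component_avoiding_domain_False:
  fixes \<Omega> :: "complex set" and \<phi> :: "complex \<Rightarrow> rsphere"
  assumes \<Omega>: "open \<Omega>" "connected \<Omega>" "- X \<subseteq> Fin ` closure \<Omega>" "Infty \<in> X"
    and U: "U \<in> components X" "U \<inter> Fin ` \<Omega> = {}" "Infty \<notin> U"
    and R: "R > 1" and A: "A = {z. 1 < cmod z \<and> cmod z < R}"
    and \<phi>: "continuous_on A \<phi>" "inj_on \<phi> A" "\<phi> ` A = U"
  shows False
proof -
  have U_fin: "U \<subseteq> range Fin"
  proof
    fix x assume "x \<in> U" then show "x \<in> range Fin" using U(3) by (cases x) auto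
  qed
  define \<psi> where "\<psi> = inv Fin \<circ> \<phi>"
  have Fin_\<psi>: "Fin (\<psi> z) = \<phi> z" if "z \<in> A" for z
    using U_fin \<phi>(3) that by (auto simp: \<psi>_def intro!: f_inv_into_f)
  have opA: "open A" unfolding A by (intro open_Collect_conj open_Collect_less continuous_intros)
  have cont: "continuous_on A \<psi>"
    unfolding \<psi>_def by (rule continuous_on_compose[OF \<phi>(1)]) (simp add: \<phi>(3) continuous_on_inv_Fin U_fin)
  have inj: "inj_on \<psi> A" using \<phi>(2) Fin_\<psi> by (metis inj_onI inj_onD)
  have \<psi>U: "z \<in> \<psi> ` A" if z: "Fin z \<in> U" for z
  proof -
    obtain y where y: "y \<in> A" "Fin z = \<phi> y" using z \<phi>(3) by blast
    then have "Fin z = Fin (\<psi> y)" using Fin_\<psi>[OF y(1)] by (simp only:)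
    then have "z = \<psi> y" by simp
    then show ?thesis using y(1) by blast
  qed
  have op\<psi>: "open (\<psi> ` B)" if "open B" "B \<subseteq> A" for B
    using invariance_of_domain that cont inj by (meson continuous_on_subset inj_on_subset)
  \<comment> \<open>The side \<open>T\<close> of the core curve \<open>\<Gamma>\<close> that misses the domain lies in \<open>U\<close>, so its closure
    pulls back to a compact subset of the annulus on which \<open>cmod\<close> has no extremum off the core circle.\<close>
  define r where "r = (1 + R) / 2"
  have r: "1 < r" "r < R" using R by (auto simp: r_def)
  then have rA: "sphere 0 r \<subseteq> A" by (auto simp: A)
  define \<Gamma> where "\<Gamma> = \<psi> ` sphere 0 r"
  have \<Gamma>: "closed_jordan_curve \<Gamma>"
  proof -
    have "closed_jordan_curve (sphere (0::complex) r)"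
      unfolding closed_jordan_curve_def using r
      by (intro exI[of _ "circlepath 0 r"]) (simp add: simple_path_circlepath)
    then show ?thesis unfolding \<Gamma>_def using cont inj rA
      by (meson closed_jordan_curve_homeo_image continuous_on_subset inj_on_subset)
  qed
  have Fin\<Gamma>: "Fin ` \<Gamma> \<subseteq> U" using Fin_\<psi> rA \<phi>(3) by (auto simp: \<Gamma>_def)
  then have "\<Omega> \<inter> \<Gamma> = {}" using U(2) by blast
  then obtain S T where T: "open T" "connected T" "S \<inter> T = {}" "frontier T = \<Gamma>" "T \<noteq> {}" "\<Omega> \<subseteq> S"
    by (rule Jordan_sides[OF \<Gamma> \<Omega>(2)])
  have clT: "closure T = T \<union> \<Gamma>" using T(4) closure_Un_frontier by blast
  have disj: "T \<inter> \<Gamma> = {}" using T(1,4) by (metis frontier_disjoint_eq Int_commute)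
  have "T \<inter> \<Omega> = {}" using T by blast
  then have "T \<inter> closure \<Omega> = {}" using T(1) by (simp add: open_Int_closure_eq_empty)
  then have FinT: "Fin ` closure T \<subseteq> X"
    using \<Omega>(3) Fin\<Gamma> in_components_subset[OF U(1)] unfolding clT by blast
  have "\<Gamma> \<noteq> {}" using r by (auto simp: \<Gamma>_def sphere_eq_empty)
  then have meet: "Fin ` closure T \<inter> U \<noteq> {}" using Fin\<Gamma> unfolding clT by blast
  have con: "connected (Fin ` closure T)"
    by (intro connected_continuous_image continuous_on_Fin connected_imp_connected_closure T)
  have "bounded T"
  proof (rule ccontr)
    assume "\<not> bounded T"
    then have "Infty \<in> closure (Fin ` closure T)"
      using Infty_in_closure_unbounded bounded_subset closure_subset by metis
    then have "connected (insert Infty (Fin ` closure T))"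
      using con by (metis closure_subset connected_intermediate_closure insert_subset subset_insertI)
    then have "insert Infty (Fin ` closure T) \<subseteq> U"
      using subset_component_if_connected[OF U(1)] FinT \<Omega>(4) meet by blast
    then show False using U(3) by blast
  qed
  then have cpt: "compact (closure T)" by simp
  have TU: "Fin ` closure T \<subseteq> U" using subset_component_if_connected[OF U(1) con FinT meet] .
  define L where "L = inv_into A \<psi> ` closure T"
  have T\<psi>: "closure T \<subseteq> \<psi> ` A" using TU \<psi>U by blast
  have "continuous_on (\<psi> ` A) (inv_into A \<psi>)"
    unfolding continuous_on_open_invariant
  proof (intro allI impI)
    fix B :: "complex set" assume "open B"
    then have "open (\<psi> ` (A \<inter> B))" using opA by (intro op\<psi>) auto
    moreover have "\<psi> ` (A \<inter> B) \<inter> \<psi> ` A = inv_into A \<psi> -` B \<inter> \<psi> ` A"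
      using inj by (auto simp: inv_into_f_f dest: inj_onD)
    ultimately show "\<exists>C. open C \<and> C \<inter> \<psi> ` A = inv_into A \<psi> -` B \<inter> \<psi> ` A" by blast
  qed
  then have "compact L" unfolding L_def using cpt T\<psi>
    by (meson compact_continuous_image continuous_on_subset)
  have L_iff: "z \<in> L \<longleftrightarrow> z \<in> A \<and> \<psi> z \<in> closure T" for z
    using T\<psi> inj by (auto simp: L_def f_inv_into_f inv_into_into image_iff subset_iff intro!: bexI[of _ "\<psi> z"])
  have inner: "open (A \<inter> \<psi> -` T)" using cont opA T(1) by (metis Int_commute continuous_on_open_vimage)
  have onT: "\<psi> z \<in> T" if "z \<in> L" "cmod z \<noteq> r" for z
  proof -
    have "\<psi> z \<notin> \<Gamma>"
    proof
      assume "\<psi> z \<in> \<Gamma>"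
      then obtain y where "cmod y = r" "\<psi> z = \<psi> y" by (auto simp: \<Gamma>_def)
      then show False using inj rA that L_iff by (metis inj_onD mem_sphere_0 subsetD)
    qed
    then show ?thesis using that(1) L_iff clT by blast
  qed
  have sub: "A \<inter> \<psi> -` T \<subseteq> L" using L_iff clT by blast
  obtain z\<^sub>0 where z\<^sub>0: "z\<^sub>0 \<in> A" "\<psi> z\<^sub>0 \<in> T" using T(5) T\<psi> closure_subset[of T] by blast
  then have z\<^sub>0L: "z\<^sub>0 \<in> L" using sub by blast
  have "cmod z\<^sub>0 \<noteq> r" using z\<^sub>0(2) disj by (auto simp: \<Gamma>_def)
  \<comment> \<open>The side on which \<open>z\<^sub>0\<close> lies decides between maximum and
    minimum: an extremum of \<open>cmod\<close> over the compact set \<open>L\<close> beyond or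
    below \<open>r\<close> is off the core circle, hence interior to \<open>L\<close>, which is
    impossible.\<close>
  then consider "cmod z\<^sub>0 > r" | "cmod z\<^sub>0 < r" by linarith
  then show False
  proof cases
    case 1
    obtain z\<^sub>1 where z\<^sub>1: "z\<^sub>1 \<in> L" "\<And>z. z \<in> L \<Longrightarrow> cmod z \<le> cmod z\<^sub>1"
      using continuous_attains_sup[OF \<open>compact L\<close>, of cmod] z\<^sub>0L continuous_on_norm_id by blast
    then have "cmod z\<^sub>1 \<noteq> r" using 1 z\<^sub>0L by force
    then have "z\<^sub>1 \<in> A \<inter> \<psi> -` T" using onT z\<^sub>1(1) L_iff by blast
    then show False using ex_norm_greater_in_open[OF inner] z\<^sub>1(2) sub by force
  next
    case 2
    obtain z\<^sub>1 where z\<^sub>1: "z\<^sub>1 \<in> L" "\<And>z. z \<in> L \<Longrightarrow> cmod z\<^sub>1 \<le> cmod z"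
      using continuous_attains_inf[OF \<open>compact L\<close>, of cmod] z\<^sub>0L continuous_on_norm_id by blast
    then have "cmod z\<^sub>1 \<noteq> r" using 2 z\<^sub>0L by force
    then have "z\<^sub>1 \<in> A \<inter> \<psi> -` T" using onT z\<^sub>1(1) L_iff by blast
    moreover from this have "z\<^sub>1 \<noteq> 0" by (auto simp: A)
    ultimately show False using ex_norm_less_in_open[OF inner] z\<^sub>1(2) sub by force
  qed
qed

lemma ex_root_of_unity_neq_1:
  assumes "n \<ge> 2" obtains \<omega> :: complex where "\<omega> ^ n = 1" "\<omega> \<noteq> 1" "cmod \<omega> = 1"
proof -
  have "card {z::complex. z ^ n = 1} = n" using assms by (intro card_roots_unity_eq) auto
  then have "\<not> {z::complex. z ^ n = 1} \<subseteq> {1}"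
    using assms card_mono[of "{1::complex}" "{z. z ^ n = 1}"] by force
  then obtain \<omega> :: complex where w: "\<omega> ^ n = 1" "\<omega> \<noteq> 1" by blast
  then have "cmod \<omega> ^ n = 1" by (metis norm_one norm_power)
  then have "cmod \<omega> = 1" using assms power_eq_imp_eq_base[of "cmod \<omega>" n 1] by simp
  then show ?thesis using that w by blast
qed

lemma cis_irrational_neq_1:
  assumes "\<theta> \<notin> \<rat>" shows "cis (2 * pi * \<theta>) \<noteq> 1"
proof
  assume "cis (2 * pi * \<theta>) = 1"
  then have "cos (2 * pi * \<theta>) = 1" by (simp add: complex_eq_iff)
  then obtain k :: int where "2 * pi * \<theta> = of_int k * 2 * pi" using cos_one_2pi_int by blast
  then have "\<theta> = of_int k" by simp
  then show False using assms by simp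
qed

lemma (in f_family) no_herman_ring: "\<not> herman_ring (f_map n c) U"
proof
  assume "herman_ring (f_map n c) U"
  then obtain p R \<theta> \<phi> A where U: "U \<in> components (fatou_set (f_map n c))"
    and p: "p \<ge> 1" and R: "R > 1" and \<theta>: "\<theta> \<notin> \<rat>" and A: "A = {z::complex. 1 < cmod z \<and> cmod z < R}"
    and \<phi>: "sphere_holomorphic_on \<phi> A" "inj_on \<phi> A" "\<phi> ` A = U"
      "\<And>z. z \<in> A \<Longrightarrow> (f_map n c ^^ p) (\<phi> z) = \<phi> (cis (2 * pi * \<theta>) * z)"
    unfolding herman_ring_def Let_def by blast
  obtain \<Omega> s where \<Omega>: "open \<Omega>" "connected \<Omega>" "Fin ` \<Omega> \<subseteq> fatou_set (f_map n c)"
    "julia_set (f_map n c) \<subseteq> Fin ` (closure \<Omega> - \<Omega>)" "s > 0" "sphere 0 s \<subseteq> \<Omega>"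
    by (rule ex_plane_basin)
  have rot: "cis (2 * pi * \<theta>) * z \<in> A" if "z \<in> A" for z
    using that by (simp add: A norm_mult)
  have "inj_on (f_map n c ^^ p) U"
  proof (rule inj_onI)
    fix x y assume xy: "x \<in> U" "y \<in> U" "(f_map n c ^^ p) x = (f_map n c ^^ p) y"
    then obtain a b where ab: "a \<in> A" "b \<in> A" "x = \<phi> a" "y = \<phi> b" using \<phi>(3) by blast
    then have "\<phi> (cis (2 * pi * \<theta>) * a) = \<phi> (cis (2 * pi * \<theta>) * b)" using xy \<phi>(4) by metis
    then have "cis (2 * pi * \<theta>) * a = cis (2 * pi * \<theta>) * b" using \<phi>(2) rot ab by (meson inj_onD)
    then show "x = y" using ab by simp
  qed
  \<comment> \<open>The iterate \<open>f ^^ p\<close> is conjugate to a rotation on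
    \<open>U\<close>, hence injective there; injectivity passes to the first map applied, since
    \<open>p \<ge> 1\<close>.\<close>
  have inj: "x = y" if "x \<in> U" "y \<in> U" "f_map n c x = f_map n c y" for x y
  proof -
    have "f_map n c ^^ p = (f_map n c ^^ (p - 1)) \<circ> f_map n c"
      using p by (metis Suc_diff_1 funpow_Suc_right less_le_trans zero_less_one)
    then have "(f_map n c ^^ p) x = (f_map n c ^^ p) y" using that(3) by simp
    then show ?thesis using \<open>inj_on (f_map n c ^^ p) U\<close> that by (meson inj_onD)
  qed
  have "U \<inter> Fin ` \<Omega> = {}"
  proof (rule ccontr)
    assume "U \<inter> Fin ` \<Omega> \<noteq> {}"
    moreover have "connected (Fin ` \<Omega>)"
      by (intro connected_continuous_image continuous_on_Fin \<Omega>)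
    ultimately have sub: "Fin ` \<Omega> \<subseteq> U"
      using subset_component_if_connected[OF U] \<Omega>(3) by blast
    \<comment> \<open>The map depends on \<open>z ^ n\<close> alone, so the two points
      \<open>s\<close> and \<open>\<omega> * s\<close> of the circle inside \<Omega> have the same
      image.\<close>
    obtain \<omega> :: complex where \<omega>: "\<omega> ^ n = 1" "\<omega> \<noteq> 1" "cmod \<omega> = 1"
      using n ex_root_of_unity_neq_1[of n] by auto
    have "complex_of_real s \<in> \<Omega>" "\<omega> * complex_of_real s \<in> \<Omega>"
      using \<Omega>(5,6) \<omega>(3) by (auto simp: norm_mult subset_iff)
    then have "Fin (complex_of_real s) \<in> U" "Fin (\<omega> * complex_of_real s) \<in> U" using sub by blast+
    moreover have "f_map n c (Fin (\<omega> * complex_of_real s)) = f_map n c (Fin (complex_of_real s))"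
      using \<omega>(1) by (simp add: power_mult_distrib)
    ultimately have "Fin (\<omega> * complex_of_real s) = Fin (complex_of_real s)" using inj by blast
    then show False using \<omega>(2) \<Omega>(5) by simp
  qed
  \<comment> \<open>\<open>Infty\<close> is fixed by the map, whereas an irrational rotation has no
    fixed point in the annulus.\<close>
  moreover have "Infty \<notin> U"
  proof
    assume "Infty \<in> U"
    then obtain z where z: "z \<in> A" "\<phi> z = Infty" using \<phi>(3) by auto
    have "(f_map n c ^^ k) Infty = Infty" for k by (induction k) auto
    then have "\<phi> (cis (2 * pi * \<theta>) * z) = \<phi> z" using \<phi>(4)[OF z(1)] z(2) by simp
    then have "cis (2 * pi * \<theta>) * z = z" using \<phi>(2) rot z(1) by (meson inj_onD)
    moreover have "z \<noteq> 0" using z(1) by (auto simp: A)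
    ultimately show False using cis_irrational_neq_1[OF \<theta>] by simp
  qed
  moreover have "- fatou_set (f_map n c) \<subseteq> Fin ` closure \<Omega>" using \<Omega>(4) by (auto simp: julia_set_def)
  ultimately show False
    using annular_component_avoiding_domain_False[OF \<Omega>(1,2) _ Infty_in_fatou_set U _ _ R A
        sphere_holomorphic_on_imp_continuous_on[OF \<phi>(1)] \<phi>(2,3)] by blast
qed

theorem theorem1p2:
  fixes n :: nat and c :: complex
  assumes "n \<ge> 3" and "c \<noteq> 0"
  shows "\<not> cantor_set_of_circles (julia_set (f_map n c)) \<and>
         \<not> sierpinski_curve (julia_set (f_map n c)) \<and>
         \<not> (\<exists>U. herman_ring (f_map n c) U)"
proof -
  interpret f_family n c using assms by unfold_locales
  obtain \<Omega> s where "open \<Omega>" "connected \<Omega>" "julia_set (f_map n c) \<subseteq> Fin ` (closure \<Omega> - \<Omega>)"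
    by (rule ex_plane_basin)
  then show ?thesis
    using not_cantor_set_of_circles_if_subset_frontier not_sierpinski_curve_if_subset_frontier
      no_herman_ring by blast
qed

end
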